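(* Let $a<0$, $c<0$, $a_2>0$, $c_2>0$, $b>0$, $b_2>0$, let $0<|\omega|<\min\left\{1,\frac{-a}{b},\frac{-c}{b},\frac{a_2}{b_2},\frac{c_2}{b_2}\right\}$, and let $F:\mathbb{R}^4\to\mathbb{R}$ be $C^2$ with $F(0)=0$ satisfying conditions (a), (b), (c) of the context. Let $(\psi_0,v_0)\in X$ satisfy $P_\omega(\psi_0,v_0)=0$ and $J_\omega(\psi_0,v_0)=S(\omega)$. Then $(\psi_0,v_0)$ is a weak solution of the traveling-wave system, i.e. $J_\omega'(\psi_0,v_0)=0$ in the dual of $X$.
   Context: $X=H^2(\mathbb{R})\times H^2(\mathbb{R})$. For $(\psi,v)\in X$: $I_1(\psi,v)=\int_{\mathbb R}[\psi^2-c(\psi')^2+c_2(\psi'')^2+v^2-a(v')^2+a_2(v'')^2]\,dx$, $I_2(\psi,v)=\int_{\mathbb R}(\psi v+b\psi'v'+b_2\psi''v'')\,dx$, $I_\omega=I_1-2\omega I_2$. $F:\mathbb{R}^4\to\mathbb{R}$ is $C^2$, $F(0)=0$, $G(w)=w\cdot\nabla F(w)$. Conditions: (a) there is $p>0$ with $w\cdot\nabla G(w)\ge(p+2)G(w)$ for all $w\in\mathbb{R}^4$; (b) there exist $0<q_1\le q_2<\infty$, $C>0$ with $|D^2F(w)|\le C(|w|^{q_1}+|w|^{q_2})$; (c) there exist $u,v\in H^2(\mathbb{R})$ with $\int_{\mathbb R}F(u,u',v,v')\,dx>0$. $K(\psi,v)=\int F(\psi,\psi',v,v')\,dx$, $N(\psi,v)=\int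 G(\psi,\psi',v,v')\,dx$, $J_\omega=\tfrac12I_\omega-K$, $P_\omega=I_\omega-N$, $\mathcal M_\omega=\{P_\omega=0\}$, $S(\omega)=\inf\{J_\omega(\psi,v):(\psi,v)\in\mathcal M_\omega\setminus\{0\}\}$. Weak solutions of the traveling-wave equations of the higher-order Boussinesq system (with $b=d$, $b_2=d_2$) are, by definition, critical points of $J_\omega$ on $X$. *)

theory Defs
  imports "HOL-Analysis.Analysis"
begin

text \<open>Test functions: continuously differentiable with compact support
  (weak derivatives tested against C^1_c functions; equivalent to C^\<infinity>_c testing).\<close>
definition test_fun :: "(real \<Rightarrow> real) \<Rightarrow> bool" where
  "test_fun \<phi> \<longleftrightarrow> \<phi> C1_differentiable_on UNIV \<and> bounded {x. \<phi> x \<noteq> 0}"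

definition loc_integrable :: "(real \<Rightarrow> real) \<Rightarrow> bool" where
  "loc_integrable u \<longleftrightarrow> (\<forall>r s. set_integrable lborel {r..s} u)"

definition weak_deriv :: "(real \<Rightarrow> real) \<Rightarrow> (real \<Rightarrow> real) \<Rightarrow> bool" where
  "weak_deriv u u' \<longleftrightarrow> loc_integrable u \<and> loc_integrable u' \<and>
     (\<forall>\<phi>. test_fun \<phi> \<longrightarrow>
        (LINT x|lborel. u x * deriv \<phi> x) = - (LINT x|lborel. u' x * \<phi> x))"

definition sq_int :: "(real \<Rightarrow> real) \<Rightarrow> bool" where
  "sq_int f \<longleftrightarrow> f \<in> borel_measurable lborel \<and> integrable lborel (\<lambda>x. (f x)\<^sup>2)"

definition H2 :: "(real \<Rightarrow> real) \<Rightarrow> bool" where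
  "H2 u \<longleftrightarrow> (\<exists>u1 u2. sq_int u \<and> sq_int u1 \<and> sq_int u2 \<and> weak_deriv u u1 \<and> weak_deriv u1 u2)"

text \<open>A chosen weak derivative (determined up to a.e. equality).\<close>
definition wd :: "(real \<Rightarrow> real) \<Rightarrow> (real \<Rightarrow> real)" where
  "wd u = (SOME u'. weak_deriv u u')"

definition H2_norm_sq :: "(real \<Rightarrow> real) \<Rightarrow> real" where
  "H2_norm_sq u = (LINT x|lborel. (u x)\<^sup>2 + (wd u x)\<^sup>2 + (wd (wd u) x)\<^sup>2)"

definition X_norm :: "(real \<Rightarrow> real) \<Rightarrow> (real \<Rightarrow> real) \<Rightarrow> real" where
  "X_norm \<psi> v = sqrt (H2_norm_sq \<psi> + H2_norm_sq v)"

text \<open>Zero element of X (functions equal a.e. are identified).\<close>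
definition X_zero :: "(real \<Rightarrow> real) \<Rightarrow> (real \<Rightarrow> real) \<Rightarrow> bool" where
  "X_zero \<psi> v \<longleftrightarrow> (AE x in lborel. \<psi> x = 0 \<and> v x = 0)"

definition vec4 :: "real \<Rightarrow> real \<Rightarrow> real \<Rightarrow> real \<Rightarrow> real^4" where
  "vec4 x1 x2 x3 x4 = vector [x1, x2, x3, x4]"

definition grad :: "(real^4 \<Rightarrow> real) \<Rightarrow> real^4 \<Rightarrow> real^4" where
  "grad F w = (\<chi> i. frechet_derivative F (at w) (axis i 1))"

definition hess :: "(real^4 \<Rightarrow> real) \<Rightarrow> real^4 \<Rightarrow> real^4^4" where
  "hess F w = jacobian (grad F) (at w)"

definition C2_R4 :: "(real^4 \<Rightarrow> real) \<Rightarrow> bool" where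
  "C2_R4 F \<longleftrightarrow> (\<forall>w. F differentiable (at w)) \<and> (\<forall>w. grad F differentiable (at w))
     \<and> continuous_on UNIV (hess F)"

definition Gfun :: "(real^4 \<Rightarrow> real) \<Rightarrow> real^4 \<Rightarrow> real" where
  "Gfun F w = w \<bullet> grad F w"

definition I1 :: "real \<Rightarrow> real \<Rightarrow> real \<Rightarrow> real \<Rightarrow> (real \<Rightarrow> real) \<Rightarrow> (real \<Rightarrow> real) \<Rightarrow> real" where
  "I1 a a2 c c2 \<psi> v = (LINT x|lborel. (\<psi> x)\<^sup>2 - c * (wd \<psi> x)\<^sup>2 + c2 * (wd (wd \<psi>) x)\<^sup>2
      + (v x)\<^sup>2 - a * (wd v x)\<^sup>2 + a2 * (wd (wd v) x)\<^sup>2)"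

definition I2 :: "real \<Rightarrow> real \<Rightarrow> (real \<Rightarrow> real) \<Rightarrow> (real \<Rightarrow> real) \<Rightarrow> real" where
  "I2 b b2 \<psi> v = (LINT x|lborel. \<psi> x * v x + b * wd \<psi> x * wd v x + b2 * wd (wd \<psi>) x * wd (wd v) x)"

definition Iw :: "real \<Rightarrow> real \<Rightarrow> real \<Rightarrow> real \<Rightarrow> real \<Rightarrow> real \<Rightarrow> real \<Rightarrow> (real \<Rightarrow> real) \<Rightarrow> (real \<Rightarrow> real) \<Rightarrow> real" where
  "Iw a a2 c c2 b b2 \<omega> \<psi> v = I1 a a2 c c2 \<psi> v - 2 * \<omega> * I2 b b2 \<psi> v"

definition Kfun :: "(real^4 \<Rightarrow> real) \<Rightarrow> (real \<Rightarrow> real) \<Rightarrow> (real \<Rightarrow> real) \<Rightarrow> real" where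
  "Kfun F \<psi> v = (LINT x|lborel. F (vec4 (\<psi> x) (wd \<psi> x) (v x) (wd v x)))"

definition Nfun :: "(real^4 \<Rightarrow> real) \<Rightarrow> (real \<Rightarrow> real) \<Rightarrow> (real \<Rightarrow> real) \<Rightarrow> real" where
  "Nfun F \<psi> v = (LINT x|lborel. Gfun F (vec4 (\<psi> x) (wd \<psi> x) (v x) (wd v x)))"

definition Jw where
  "Jw a a2 c c2 b b2 \<omega> F \<psi> v = Iw a a2 c c2 b b2 \<omega> \<psi> v / 2 - Kfun F \<psi> v"

definition Pw where
  "Pw a a2 c c2 b b2 \<omega> F \<psi> v = Iw a a2 c c2 b b2 \<omega> \<psi> v - Nfun F \<psi> v"

definition Sw where
  "Sw a a2 c c2 b b2 \<omega> F = Inf {Jw a a2 c c2 b b2 \<omega> F \<psi> v | \<psi> v.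
      H2 \<psi> \<and> H2 v \<and> Pw a a2 c c2 b b2 \<omega> F \<psi> v = 0 \<and> \<not> X_zero \<psi> v}"

definition Jw_critical where
  "Jw_critical a a2 c c2 b b2 \<omega> F \<psi>0 v0 \<longleftrightarrow>
     (\<forall>\<epsilon>>0. \<exists>\<delta>>0. \<forall>h k. H2 h \<and> H2 k \<and> X_norm h k < \<delta> \<longrightarrow>
        \<bar>Jw a a2 c c2 b b2 \<omega> F (\<lambda>x. \<psi>0 x + h x) (\<lambda>x. v0 x + k x) - Jw a a2 c c2 b b2 \<omega> F \<psi>0 v0\<bar>
          \<le> \<epsilon> * X_norm h k)"

end

(* Write J for the functional and P for the Nehari constraint. Condition (a) gives
   G(tw) >= t^(p+2) G(w) for t >= 1. Hence on the ray through a nonzero z with P(z) = 0 the sign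
   of P changes from + to - at z, and J restricted to the ray is maximal at z; moreover J >= 0 on
   the Nehari manifold. If J'(z) were negative in some direction y, then for small s > 0 the
   intermediate value theorem yields t close to 1 with P(tz + sy) = 0, and
   J(tz + sy) < J(tz) <= J(z), contradicting minimality. So no Lagrange multiplier is needed.
   The functional is differentiable on X because functions in H^1 of the line are essentially
   bounded, so the Lipschitz bounds for the gradient of F on balls suffice. *)

theory Submission
  imports Defs
begin

section \<open>Square-integrable functions\<close>

definition square_integrable :: "'m measure \<Rightarrow> ('m \<Rightarrow> 'a::euclidean_space) \<Rightarrow> bool" where
  "square_integrable M f \<longleftrightarrow> f \<in> borel_measurable M \<and> integrable M (\<lambda>x. (norm (f x))\<^sup>2)"

definition ess_bounded :: "'m measure \<Rightarrow> ('m \<Rightarrow> 'a::real_normed_vector) \<Rightarrow> bool" where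
  "ess_bounded M f \<longleftrightarrow> (\<exists>R. AE x in M. norm (f x) \<le> R)"

lemma square_integrable_measurable [measurable_dest]:
  "square_integrable M f \<Longrightarrow> f \<in> borel_measurable M"
  by (simp add: square_integrable_def)

lemma integrable_norm_square: "square_integrable M f \<Longrightarrow> integrable M (\<lambda>x. (norm (f x))\<^sup>2)"
  by (simp add: square_integrable_def)

lemma integrable_bilinear:
  fixes B :: "'a::euclidean_space \<Rightarrow> 'b::euclidean_space \<Rightarrow> 'c::{banach, second_countable_topology}"
  assumes "bounded_bilinear B" and f: "square_integrable M f" and g: "square_integrable M g"
  shows "integrable M (\<lambda>x. B (f x) (g x))"
proof -
  interpret B: bounded_bilinear B
    by fact
  obtain K where K: "K \<ge> 0" "\<And>y z. norm (B y z) \<le> norm y * norm z * K"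
    using B.nonneg_bounded by blast
  show ?thesis
  proof (rule Bochner_Integration.integrable_bound)
    show "integrable M (\<lambda>x. K * ((norm (f x))\<^sup>2 + (norm (g x))\<^sup>2))"
      using f g by (simp add: integrable_norm_square)
    show "(\<lambda>x. B (f x) (g x)) \<in> borel_measurable M"
      using f g by (intro borel_measurable_continuous_Pair[OF _ _ B.continuous_on]
          continuous_on_fst continuous_on_snd continuous_on_id square_integrable_measurable)
    have "norm (B y z) \<le> K * ((norm y)\<^sup>2 + (norm z)\<^sup>2)" for y z
    proof -
      have "0 \<le> norm y * norm z"
        by simp
      then have "norm y * norm z \<le> (norm y)\<^sup>2 + (norm z)\<^sup>2"
        using sum_squares_bound[of "norm y" "norm z"] by linarith
      then have "K * (norm y * norm z) \<le> K * ((norm y)\<^sup>2 + (norm z)\<^sup>2)"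
        using K(1) by (rule mult_left_mono)
      with K(2)[of y z] show ?thesis
        by (simp add: mult.commute)
    qed
    then show "AE x in M. norm (B (f x) (g x)) \<le> norm (K * ((norm (f x))\<^sup>2 + (norm (g x))\<^sup>2))"
      using K(1) by simp
  qed
qed

lemma square_integrable_lincomb:
  assumes f: "square_integrable M f" and g: "square_integrable M g"
  shows "square_integrable M (\<lambda>x. \<alpha> *\<^sub>R f x + \<beta> *\<^sub>R g x)"
proof -
  have expand: "(norm (\<alpha> *\<^sub>R y + \<beta> *\<^sub>R z))\<^sup>2
      = \<alpha>\<^sup>2 * (norm y)\<^sup>2 + 2 * \<alpha> * \<beta> * (y \<bullet> z) + \<beta>\<^sup>2 * (norm z)\<^sup>2" for y z :: 'b
    by (simp add: power2_norm_eq_inner inner_simps inner_commute[of z y])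
      (simp add: power2_eq_square algebra_simps)
  have "integrable M (\<lambda>x. (norm (\<alpha> *\<^sub>R f x + \<beta> *\<^sub>R g x))\<^sup>2)"
    unfolding expand using f g
    by (intro Bochner_Integration.integrable_add integrable_mult_right integrable_norm_square
        integrable_bilinear[OF bounded_bilinear_inner])
  moreover have "(\<lambda>x. \<alpha> *\<^sub>R f x + \<beta> *\<^sub>R g x) \<in> borel_measurable M"
    using f g by measurable
  ultimately show ?thesis
    by (simp add: square_integrable_def)
qed

lemma square_integrable_Pair:
  assumes "square_integrable M f" "square_integrable M g"
  shows "square_integrable M (\<lambda>x. (f x, g x))"
  using assms by (auto simp: square_integrable_def norm_Pair)

lemma square_integrable_cong_AE:
  assumes "square_integrable M f" "AE x in M. f x = g x" "g \<in> borel_measurable M"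
  shows "square_integrable M g"
proof -
  have "integrable M (\<lambda>x. (norm (g x))\<^sup>2)"
  proof (rule integrable_cong_AE_imp)
    show "integrable M (\<lambda>x. (norm (f x))\<^sup>2)"
      using assms(1) by (rule integrable_norm_square)
    show "AE x in M. (norm (f x))\<^sup>2 = (norm (g x))\<^sup>2"
      using assms(2) by eventually_elim simp
  qed (use assms(3) in measurable)
  with assms(3) show ?thesis
    by (simp add: square_integrable_def)
qed

lemma ess_boundedE:
  assumes "ess_bounded M f"
  obtains R where "R \<ge> 0" "AE x in M. norm (f x) \<le> R"
proof -
  obtain R where "AE x in M. norm (f x) \<le> R"
    using assms by (auto simp: ess_bounded_def)
  then have "AE x in M. norm (f x) \<le> \<bar>R\<bar>"
    by eventually_elim linarith
  then show thesis
    by (rule that[rotated]) simp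
qed

lemma norm_lincomb_le:
  fixes y z :: "'a::real_inner"
  shows "norm (fst p *\<^sub>R y + snd p *\<^sub>R z) \<le> norm p * norm (y, z)"
proof -
  have "norm (fst p *\<^sub>R y + snd p *\<^sub>R z) \<le> \<bar>fst p\<bar> * norm y + \<bar>snd p\<bar> * norm z"
    by (rule norm_triangle_le) simp
  also have "\<dots> = (\<bar>fst p\<bar>, \<bar>snd p\<bar>) \<bullet> (norm y, norm z)"
    by simp
  also have "\<dots> \<le> norm (\<bar>fst p\<bar>, \<bar>snd p\<bar>) * norm (norm y, norm z)"
    by (rule norm_cauchy_schwarz)
  also have "\<dots> = norm p * norm (y, z)"
    by (simp add: norm_Pair norm_prod_def)
  finally show ?thesis .
qed

lemma norm_lincomb_Pair_square_le:
  fixes y z :: "'a::real_inner"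
  assumes p: "norm p \<le> A"
  shows "(norm (fst p *\<^sub>R y + snd p *\<^sub>R z, z))\<^sup>2 \<le> (A\<^sup>2 + 1) * (norm (y, z))\<^sup>2"
proof -
  have "norm (fst p *\<^sub>R y + snd p *\<^sub>R z) \<le> A * norm (y, z)"
    by (rule order_trans[OF norm_lincomb_le mult_right_mono[OF p]]) simp
  then have "(norm (fst p *\<^sub>R y + snd p *\<^sub>R z))\<^sup>2 \<le> A\<^sup>2 * (norm (y, z))\<^sup>2"
    unfolding power_mult_distrib[symmetric] by (rule power_mono) simp
  moreover have "(norm z)\<^sup>2 \<le> (norm (y, z))\<^sup>2"
    by (simp add: norm_Pair)
  moreover have "(norm (fst p *\<^sub>R y + snd p *\<^sub>R z, z))\<^sup>2
      = (norm (fst p *\<^sub>R y + snd p *\<^sub>R z))\<^sup>2 + (norm z)\<^sup>2"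
    by (simp add: norm_Pair)
  ultimately show ?thesis
    unfolding distrib_right mult_1 by linarith
qed

lemma ess_bounded_lincomb:
  assumes f: "ess_bounded M f" and g: "ess_bounded M g"
  shows "ess_bounded M (\<lambda>x. \<alpha> *\<^sub>R f x + \<beta> *\<^sub>R g x)"
proof -
  obtain R S where "AE x in M. norm (f x) \<le> R" "AE x in M. norm (g x) \<le> S"
    using f g by (auto simp: ess_bounded_def)
  then have "AE x in M. norm (\<alpha> *\<^sub>R f x + \<beta> *\<^sub>R g x) \<le> \<bar>\<alpha>\<bar> * R + \<bar>\<beta>\<bar> * S"
    by eventually_elim (auto intro!: norm_triangle_le add_mono mult_left_mono)
  then show ?thesis
    unfolding ess_bounded_def by blast
qed

context
  fixes M :: "'m measure" and W V :: "'m \<Rightarrow> 'a::euclidean_space" and g :: "'a \<Rightarrow> 'a \<Rightarrow> real"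
  assumes W: "square_integrable M W" "ess_bounded M W" and V: "square_integrable M V" "ess_bounded M V"
    and g: "continuous_on UNIV (\<lambda>p. g (fst p) (snd p))"
    and bound: "\<And>R. 0 \<le> R \<Longrightarrow> \<exists>C\<ge>0. \<forall>w h. norm w \<le> R \<longrightarrow> \<bar>g w h\<bar> \<le> C * (norm (w, h))\<^sup>2"
begin

lemma measurable_superposition:
  "(\<lambda>x. g (fst p *\<^sub>R W x + snd p *\<^sub>R V x) (V x)) \<in> borel_measurable M"
proof -
  have [measurable]: "W \<in> borel_measurable M" "V \<in> borel_measurable M"
    using W(1) V(1) by (simp_all add: square_integrable_def)
  show ?thesis
    by (intro borel_measurable_continuous_Pair[OF _ _ g]) measurable
qed

lemma superposition_dominated:
  assumes "0 \<le> A"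
  obtains D where "integrable M D"
    "\<And>p. norm p \<le> A \<Longrightarrow> AE x in M. norm (g (fst p *\<^sub>R W x + snd p *\<^sub>R V x) (V x)) \<le> D x"
proof -
  obtain R where R: "0 \<le> R" "AE x in M. norm (W x) \<le> R"
    by (rule ess_boundedE[OF W(2)])
  obtain S where S: "0 \<le> S" "AE x in M. norm (V x) \<le> S"
    by (rule ess_boundedE[OF V(2)])
  obtain C where C: "0 \<le> C" "\<And>w h. norm w \<le> A * (R + S) \<Longrightarrow> \<bar>g w h\<bar> \<le> C * (norm (w, h))\<^sup>2"
    using bound[of "A * (R + S)"] \<open>0 \<le> A\<close> R(1) S(1) by auto
  let ?D = "\<lambda>x. C * ((A\<^sup>2 + 1) * (norm (W x, V x))\<^sup>2)"
  show thesis
  proof (rule that)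
    show "integrable M ?D"
      using square_integrable_Pair[OF W(1) V(1)] by (simp add: integrable_norm_square)
    fix p :: "real \<times> real" assume p: "norm p \<le> A"
    show "AE x in M. norm (g (fst p *\<^sub>R W x + snd p *\<^sub>R V x) (V x)) \<le> ?D x"
      using R(2) S(2)
    proof eventually_elim
      case (elim x)
      let ?U = "fst p *\<^sub>R W x + snd p *\<^sub>R V x"
      have "norm (W x, V x) \<le> R + S"
        using elim norm_Pair_le[of "W x" "V x"] by linarith
      then have "norm ?U \<le> A * (R + S)"
        using \<open>0 \<le> A\<close> by (intro order_trans[OF norm_lincomb_le mult_mono[OF p]]) auto
      then have "\<bar>g ?U (V x)\<bar> \<le> C * (norm (?U, V x))\<^sup>2"
        by (rule C(2))
      also have "\<dots> \<le> ?D x"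
        using norm_lincomb_Pair_square_le[OF p] C(1) by (rule mult_left_mono)
      finally show ?case
        by simp
    qed
  qed
qed

lemma integrable_superposition: "integrable M (\<lambda>x. g (\<alpha> *\<^sub>R W x + \<beta> *\<^sub>R V x) (V x))"
proof -
  obtain D where D: "integrable M D"
    "\<And>p. norm p \<le> norm (\<alpha>, \<beta>) \<Longrightarrow> AE x in M. norm (g (fst p *\<^sub>R W x + snd p *\<^sub>R V x) (V x)) \<le> D x"
    using superposition_dominated[OF norm_ge_zero[of "(\<alpha>, \<beta>)"]] by blast
  from D(2)[of "(\<alpha>, \<beta>)"] measurable_superposition[of "(\<alpha>, \<beta>)"] show ?thesis
    by (intro Bochner_Integration.integrable_bound[OF D(1)]) (auto elim!: eventually_mono)
qed

lemma continuous_on_integral_superposition: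
  "continuous_on UNIV (\<lambda>p. LINT x|M. g (fst p *\<^sub>R W x + snd p *\<^sub>R V x) (V x))"
proof -
  define U where "U p x = fst p *\<^sub>R W x + snd p *\<^sub>R V x" for p x
  have "(\<lambda>n. LINT x|M. g (U (p n) x) (V x)) \<longlonglongrightarrow> (LINT x|M. g (U q x) (V x))" if lim: "p \<longlonglongrightarrow> q" for p q
  proof -
    obtain A where A: "0 < A" "\<And>n. norm (p n) \<le> A"
      using convergent_imp_Bseq[OF convergentI[OF lim]] by (auto elim: BseqE)
    obtain D where D: "integrable M D"
      "\<And>p. norm p \<le> A \<Longrightarrow> AE x in M. norm (g (fst p *\<^sub>R W x + snd p *\<^sub>R V x) (V x)) \<le> D x"
      using superposition_dominated[OF less_imp_le[OF A(1)]] by blast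
    show ?thesis
      unfolding U_def
    proof (rule integral_dominated_convergence[OF measurable_superposition measurable_superposition
          D(1) _ D(2)[OF A(2)]], rule AE_I2, fold U_def)
      fix x
      have "(\<lambda>n. (U (p n) x, V x)) \<longlonglongrightarrow> (U q x, V x)"
        unfolding U_def by (intro tendsto_intros lim)
      then show "(\<lambda>n. g (U (p n) x) (V x)) \<longlonglongrightarrow> g (U q x) (V x)"
        using continuous_on_tendsto_compose[OF g, of "\<lambda>n. (U (p n) x, V x)" "(U q x, V x)"] by simp
    qed
  qed
  then show ?thesis
    unfolding continuous_on_sequentially comp_def U_def by blast
qed

end

section \<open>Weak derivatives and the Sobolev bound\<close>

lemma test_funI:
  assumes "\<And>x. (\<phi> has_real_derivative \<phi>' x) (at x)" "continuous_on UNIV \<phi>'"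
    and "\<And>x. x \<notin> B \<Longrightarrow> \<phi> x = 0" "bounded B"
  shows "test_fun \<phi>"
proof -
  have "{x. \<phi> x \<noteq> 0} \<subseteq> B"
    using assms(3) by auto
  then have "bounded {x. \<phi> x \<noteq> 0}"
    using assms(4) bounded_subset by blast
  then show ?thesis
    using assms(1,2) unfolding test_fun_def C1_differentiable_on_def
    by (auto simp: has_real_derivative_iff_has_vector_derivative)
qed

lemma test_fun_has_derivative:
  assumes "test_fun \<phi>"
  shows "(\<phi> has_real_derivative deriv \<phi> x) (at x)"
proof -
  obtain D where "(\<phi> has_real_derivative D) (at x)"
    using assms unfolding test_fun_def C1_differentiable_on_def
    by (auto simp: has_real_derivative_iff_has_vector_derivative)
  then show ?thesis
    using DERIV_imp_deriv by metis
qed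

lemma test_fun_continuous:
  assumes "test_fun \<phi>"
  shows "continuous_on UNIV \<phi>" "continuous_on UNIV (deriv \<phi>)"
proof -
  show "continuous_on UNIV \<phi>"
    using test_fun_has_derivative[OF assms] DERIV_isCont continuous_at_imp_continuous_on by blast
  obtain D where D: "continuous_on UNIV D" "\<And>x. (\<phi> has_vector_derivative D x) (at x)"
    using assms unfolding test_fun_def C1_differentiable_on_def by auto
  then have "deriv \<phi> = D"
    by (auto intro!: ext DERIV_imp_deriv simp: has_real_derivative_iff_has_vector_derivative)
  with D show "continuous_on UNIV (deriv \<phi>)"
    by simp
qed

lemma test_fun_bounded_support:
  assumes "test_fun \<phi>"
  shows "bounded {x. \<phi> x \<noteq> 0}" "bounded {x. deriv \<phi> x \<noteq> 0}"
proof -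
  show bounded: "bounded {x. \<phi> x \<noteq> 0}"
    using assms by (simp add: test_fun_def)
  have "deriv \<phi> x = 0" if "x \<notin> closure {x. \<phi> x \<noteq> 0}" for x
  proof (rule DERIV_imp_deriv)
    show "(\<phi> has_field_derivative 0) (at x)"
      by (rule has_field_derivative_transform_within_open[where S = "- closure {x. \<phi> x \<noteq> 0}",
        OF DERIV_const[of 0]])
        (use that closure_subset[of "{x. \<phi> x \<noteq> 0}"] in auto)
  qed
  then have "{x. deriv \<phi> x \<noteq> 0} \<subseteq> closure {x. \<phi> x \<noteq> 0}"
    by blast
  then show "bounded {x. deriv \<phi> x \<noteq> 0}"
    using bounded bounded_closure bounded_subset by blast
qed

lemma loc_integrableD: "loc_integrable f \<Longrightarrow> set_integrable lborel {r..s} f"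
  by (simp add: loc_integrable_def)

lemma loc_integrable_measurable:
  assumes "loc_integrable f"
  shows "f \<in> borel_measurable lborel"
proof (rule borel_measurable_LIMSEQ_metric)
  show "(\<lambda>x. indicator {-real n..real n} x *\<^sub>R f x) \<in> borel_measurable lborel" for n
    using loc_integrableD[OF assms] by (auto simp: set_integrable_def)
  show "(\<lambda>n. indicator {-real n..real n} x *\<^sub>R f x) \<longlonglongrightarrow> f x" for x
  proof (rule tendsto_eventually)
    obtain N where "\<bar>x\<bar> \<le> real N"
      using real_arch_simple by blast
    then show "\<forall>\<^sub>F n in sequentially. indicator {-real n..real n} x *\<^sub>R f x = f x"
      by (intro eventually_sequentiallyI[of N]) (auto simp: indicator_def abs_le_iff)
  qed
qed

lemma integrable_loc_integrable_mult:
  assumes f: "loc_integrable f" and g: "continuous_on UNIV g" "\<And>x. x \<notin> {r..s} \<Longrightarrow> g x = 0"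
  shows "integrable lborel (\<lambda>x. f x * g x)"
proof -
  have "bounded (g ` {r..s})"
    by (intro compact_imp_bounded compact_continuous_image continuous_on_subset[OF g(1)]) auto
  then obtain C where C: "C > 0" "\<And>x. x \<in> {r..s} \<Longrightarrow> \<bar>g x\<bar> \<le> C"
    unfolding bounded_pos by force
  show ?thesis
  proof (rule Bochner_Integration.integrable_bound)
    show "integrable lborel (\<lambda>x. C * (indicator {r..s} x *\<^sub>R f x))"
      using loc_integrableD[OF f] by (simp add: set_integrable_def)
    show "(\<lambda>x. f x * g x) \<in> borel_measurable lborel"
      using loc_integrable_measurable[OF f] borel_measurable_continuous_onI[OF g(1)] by simp
    show "AE x in lborel. norm (f x * g x) \<le> norm (C * (indicator {r..s} x *\<^sub>R f x))"
    proof (rule AE_I2)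
      fix x
      have "\<bar>g x\<bar> \<le> C * indicator {r..s} x"
        using g(2)[of x] C(2)[of x] by (auto simp: indicator_def)
      then have "\<bar>f x\<bar> * \<bar>g x\<bar> \<le> \<bar>f x\<bar> * (C * indicator {r..s} x)"
        by (rule mult_left_mono) simp
      then show "norm (f x * g x) \<le> norm (C * (indicator {r..s} x *\<^sub>R f x))"
        using C(1) by (simp add: abs_mult mult_ac)
    qed
  qed
qed

lemma integrable_mult_test_fun:
  assumes "loc_integrable f" "test_fun \<phi>"
  shows "integrable lborel (\<lambda>x. f x * \<phi> x)" "integrable lborel (\<lambda>x. f x * deriv \<phi> x)"
proof -
  have "integrable lborel (\<lambda>x. f x * g x)" if g: "continuous_on UNIV g" "bounded {x. g x \<noteq> 0}" for g
  proof -
    obtain R where "\<And>x. g x \<noteq> 0 \<Longrightarrow> \<bar>x\<bar> \<le> R"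
      using g(2) by (auto simp: bounded_iff)
    then have "g x = 0" if "x \<notin> {-R..R}" for x
      using that by (force simp: abs_le_iff)
    with assms(1) g(1) show ?thesis
      by (rule integrable_loc_integrable_mult)
  qed
  with assms(2) show "integrable lborel (\<lambda>x. f x * \<phi> x)" "integrable lborel (\<lambda>x. f x * deriv \<phi> x)"
    by (simp_all add: test_fun_continuous test_fun_bounded_support)
qed

lemma loc_integrable_lincomb:
  assumes "loc_integrable f" "loc_integrable g"
  shows "loc_integrable (\<lambda>x. \<alpha> * f x + \<beta> * g x)"
  using assms unfolding loc_integrable_def
  by (intro allI set_integral_add(1) set_integrable_mult_right impI) blast+

lemma loc_integrable_const: "loc_integrable (\<lambda>_. c)"
  unfolding loc_integrable_def by (auto intro!: borel_integrable_atLeastAtMost')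

lemma loc_integrable_cong_AE:
  assumes "loc_integrable f" "AE x in lborel. f x = g x" "g \<in> borel_measurable lborel"
  shows "loc_integrable g"
  unfolding loc_integrable_def set_integrable_def
proof (intro allI)
  fix r s :: real
  show "integrable lborel (\<lambda>x. indicator {r..s} x *\<^sub>R g x)"
  proof (rule integrable_cong_AE_imp)
    show "integrable lborel (\<lambda>x. indicator {r..s} x *\<^sub>R f x)"
      using loc_integrableD[OF assms(1)] by (simp add: set_integrable_def)
    show "AE x in lborel. indicator {r..s} x *\<^sub>R f x = indicator {r..s} x *\<^sub>R g x"
      using assms(2) by eventually_elim simp
  qed (use assms(3) in simp)
qed

lemma has_real_derivative_square_max_0:
  "((\<lambda>x::real. (max 0 x)\<^sup>2) has_real_derivative 2 * max 0 x) (at x)"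
proof -
  consider "x < 0" | "x = 0" | "x > 0"
    by linarith
  then show ?thesis
  proof cases
    case 1
    have "((\<lambda>x. (max 0 x)\<^sup>2) has_real_derivative 0) (at x)"
      by (rule has_field_derivative_transform_within_open[where S = "{..<0}", OF DERIV_const[of 0]])
        (use 1 in auto)
    with 1 show ?thesis
      by simp
  next
    case 2
    have "\<exists>g. (\<forall>z. (max 0 z)\<^sup>2 - (max 0 (0::real))\<^sup>2 = g z * (z - 0)) \<and> isCont g 0 \<and> g 0 = 0"
      by (intro exI[of _ "max 0"]) (auto intro!: continuous_intros simp: max_def power2_eq_square)
    with 2 show ?thesis
      by (simp add: CARAT_DERIV)
  next
    case 3
    have "((\<lambda>x. (max 0 x)\<^sup>2) has_real_derivative 2 * x) (at x)"
      by (rule has_field_derivative_transform_within_open[where S = "{0<..}" and f = "\<lambda>x. x\<^sup>2"])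
        (use 3 in \<open>auto intro!: derivative_eq_intros\<close>)
    with 3 show ?thesis
      by simp
  qed
qed

definition bump :: "real \<Rightarrow> real \<Rightarrow> real \<Rightarrow> real" where
  "bump c d x = (max 0 ((x - c) * (d - x)))\<^sup>2"

definition cutoff :: "real \<Rightarrow> real \<Rightarrow> real \<Rightarrow> real \<Rightarrow> real" where
  "cutoff \<epsilon> c d x = bump c d x / (bump c d x + \<epsilon>)"

lemma bump_nonneg: "0 \<le> bump c d x"
  by (simp add: bump_def)

lemma bump_pos: "x \<in> {c<..<d} \<Longrightarrow> 0 < bump c d x"
  by (simp add: bump_def)

lemma bump_eq_0:
  assumes "c \<le> d" "x \<notin> {c<..<d}"
  shows "bump c d x = 0"
proof -
  have "(x - c) * (d - x) \<le> 0"
    using assms by (cases "x \<le> c") (auto intro: mult_nonpos_nonneg mult_nonneg_nonpos)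
  then show ?thesis
    by (simp add: bump_def)
qed

lemma bump_has_derivative:
  "(bump c d has_real_derivative 2 * max 0 ((x - c) * (d - x)) * (c + d - 2 * x)) (at x)"
  unfolding bump_def[abs_def]
  by (rule DERIV_chain'[OF _ has_real_derivative_square_max_0, THEN DERIV_cong])
    (auto intro!: derivative_eq_intros simp: algebra_simps)

lemma test_fun_cutoff:
  assumes "0 < \<epsilon>" "c \<le> d"
  shows "test_fun (cutoff \<epsilon> c d)"
proof (rule test_funI)
  have denominator_nonzero: "bump c d x + \<epsilon> \<noteq> 0" for x
    using bump_nonneg[of c d x] assms(1) by linarith
  let ?D = "\<lambda>x. 2 * max 0 ((x - c) * (d - x)) * (c + d - 2 * x)"
  show "(cutoff \<epsilon> c d has_real_derivative ?D x * \<epsilon> / (bump c d x + \<epsilon>)\<^sup>2) (at x)" for x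
    unfolding cutoff_def[abs_def] using denominator_nonzero[of x]
    by (auto intro!: derivative_eq_intros bump_has_derivative simp: power2_eq_square algebra_simps)
  show "continuous_on UNIV (\<lambda>x. ?D x * \<epsilon> / (bump c d x + \<epsilon>)\<^sup>2)"
    unfolding bump_def using denominator_nonzero
    by (intro continuous_intros) (auto simp: bump_def)
  show "cutoff \<epsilon> c d x = 0" if "x \<notin> {c<..<d}" for x
    using bump_eq_0[OF assms(2) that] by (simp add: cutoff_def)
qed simp

lemma cutoff_bounds:
  assumes "0 < \<epsilon>"
  shows "0 \<le> cutoff \<epsilon> c d x" "cutoff \<epsilon> c d x \<le> 1"
  using assms bump_nonneg[of c d x] by (auto simp: cutoff_def divide_simps)

lemma cutoff_eq_0: "c \<le> d \<Longrightarrow> x \<notin> {c<..<d} \<Longrightarrow> cutoff \<epsilon> c d x = 0"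
  by (simp add: cutoff_def bump_eq_0)

lemma cutoff_tendsto_indicator:
  assumes "c \<le> d"
  shows "(\<lambda>n. cutoff (inverse (real (Suc n))) c d x) \<longlonglongrightarrow> indicator {c<..<d} x"
proof (cases "x \<in> {c<..<d}")
  case True
  then have "0 < bump c d x"
    by (rule bump_pos)
  then have "(\<lambda>n. cutoff (inverse (real (Suc n))) c d x) \<longlonglongrightarrow> bump c d x / (bump c d x + 0)"
    unfolding cutoff_def by (intro tendsto_intros LIMSEQ_inverse_real_of_nat) simp
  with True \<open>0 < bump c d x\<close> show ?thesis
    by simp
qed (simp add: cutoff_eq_0[OF assms])

lemma integral_nonneg_if_test:
  assumes f: "loc_integrable f" and "c \<le> d" "{c..d} \<subseteq> S"
    and test: "\<And>\<phi>. test_fun \<phi> \<Longrightarrow> (\<And>x. 0 \<le> \<phi> x) \<Longrightarrow> (\<And>x. x \<notin> S \<Longrightarrow> \<phi> x = 0)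
      \<Longrightarrow> 0 \<le> (LINT x|lborel. f x * \<phi> x)"
  shows "0 \<le> integral {c..d} f"
proof -
  let ?\<phi> = "\<lambda>n. cutoff (inverse (real (Suc n))) c d"
  have [measurable]: "f \<in> borel_measurable lborel"
    by (rule loc_integrable_measurable[OF f])
  have test_\<phi>: "test_fun (?\<phi> n)" for n
    using \<open>c \<le> d\<close> by (intro test_fun_cutoff) auto
  have "(\<lambda>n. LINT x|lborel. f x * ?\<phi> n x) \<longlonglongrightarrow> (LINT x|lborel. f x * indicator {c<..<d} x)"
  proof (rule integral_dominated_convergence)
    show "integrable lborel (\<lambda>x. norm (indicator {c..d} x *\<^sub>R f x))"
      using loc_integrableD[OF f] by (intro integrable_norm) (simp add: set_integrable_def)
    show "(\<lambda>x. f x * ?\<phi> n x) \<in> borel_measurable lborel" for n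
      using integrable_mult_test_fun(1)[OF f test_\<phi>] by (rule borel_measurable_integrable)
    show "AE x in lborel. (\<lambda>n. f x * ?\<phi> n x) \<longlonglongrightarrow> f x * indicator {c<..<d} x"
      using \<open>c \<le> d\<close> by (intro AE_I2 tendsto_intros cutoff_tendsto_indicator)
    show "AE x in lborel. norm (f x * ?\<phi> n x) \<le> norm (indicator {c..d} x *\<^sub>R f x)" for n
    proof (rule AE_I2)
      fix x
      show "norm (f x * ?\<phi> n x) \<le> norm (indicator {c..d} x *\<^sub>R f x)"
        using cutoff_bounds[of "inverse (real (Suc n))" c d x] cutoff_eq_0[OF \<open>c \<le> d\<close>, of x]
        by (cases "x \<in> {c..d}") (auto simp: abs_mult mult_left_le)
    qed
  qed measurable
  moreover have "0 \<le> (LINT x|lborel. f x * ?\<phi> n x)" for n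
    using \<open>c \<le> d\<close> \<open>{c..d} \<subseteq> S\<close> by (intro test test_\<phi> cutoff_bounds cutoff_eq_0) (auto simp: subset_iff)
  ultimately have "0 \<le> (LINT x|lborel. f x * indicator {c<..<d} x)"
    by (intro LIMSEQ_le_const) auto
  moreover have "set_integrable lborel {c<..<d} f"
    by (rule set_integrable_subset[OF loc_integrableD[OF f, of c d]]) auto
  then have "(LINT x|lborel. f x * indicator {c<..<d} x) = integral {c<..<d} f"
    using set_borel_integral_eq_integral(2)[of "{c<..<d}" f]
    by (simp add: set_lebesgue_integral_def mult.commute)
  ultimately show ?thesis
    using integral_open_interval_real[of c d f] by simp
qed

lemma AE_nonneg_if_test:
  assumes f: "loc_integrable f" and S: "open S"
    and test: "\<And>\<phi>. test_fun \<phi> \<Longrightarrow> (\<And>x. 0 \<le> \<phi> x) \<Longrightarrow> (\<And>x. x \<notin> S \<Longrightarrow> \<phi> x = 0)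
      \<Longrightarrow> 0 \<le> (LINT x|lborel. f x * \<phi> x)"
  shows "AE x in lborel. x \<in> S \<longrightarrow> 0 \<le> f x"
proof -
  have "f integrable_on cbox r s" for r s
    using set_borel_integral_eq_integral(1)[OF loc_integrableD[OF f]] by simp
  then obtain N where "negligible N"
    and differentiable: "\<And>x e. x \<notin> N \<Longrightarrow> 0 < e
      \<Longrightarrow> \<exists>d>0. \<forall>h. 0 < h \<and> h < d \<longrightarrow> norm (integral (cbox x (x + h)) f / h - f x) < e"
    by (rule integrable_ccontinuous_explicit) (auto simp: divide_inverse mult.commute)
  have nonneg: "0 \<le> f x" if "x \<in> S" "x \<notin> N" for x
  proof (rule ccontr)
    assume "\<not> 0 \<le> f x"
    then obtain d where d: "d > 0" "\<And>h. 0 < h \<Longrightarrow> h < d \<Longrightarrow> \<bar>integral {x..x+h} f / h - f x\<bar> < - f x"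
      using differentiable[OF \<open>x \<notin> N\<close>, of "- f x"] by auto
    obtain r where r: "r > 0" "cball x r \<subseteq> S"
      using S \<open>x \<in> S\<close> open_contains_cball by blast
    define h where "h = min (d / 2) r"
    have h: "0 < h" "h < d" "h \<le> r"
      using d(1) r(1) by (auto simp: h_def)
    have "{x..x+h} \<subseteq> cball x r"
      using h by (auto simp: dist_real_def)
    with r(2) have "{x..x+h} \<subseteq> S"
      by blast
    with h have "0 \<le> integral {x..x+h} f"
      by (intro integral_nonneg_if_test[OF f _ _ test]) auto
    then have "0 \<le> integral {x..x+h} f / h"
      using h(1) by simp
    with d(2)[OF h(1,2)] show False
      by linarith
  qed
  from \<open>negligible N\<close> have "AE x in lebesgue. x \<notin> N"
    by (simp add: negligible_iff_null_sets AE_not_in)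
  then have "AE x in lborel. x \<notin> N"
    by (simp add: AE_completion_iff)
  then show ?thesis
    by eventually_elim (use nonneg in blast)
qed

lemma AE_eq_0_if_test:
  assumes f: "loc_integrable f"
    and test: "\<And>\<phi>. test_fun \<phi> \<Longrightarrow> (LINT x|lborel. f x * \<phi> x) = 0"
  shows "AE x in lborel. f x = 0"
proof -
  have "AE x in lborel. x \<in> UNIV \<longrightarrow> 0 \<le> f x"
    by (rule AE_nonneg_if_test) (use f test in auto)
  moreover have "AE x in lborel. x \<in> UNIV \<longrightarrow> 0 \<le> - f x"
  proof (rule AE_nonneg_if_test)
    show "loc_integrable (\<lambda>x. - f x)"
      using loc_integrable_lincomb[OF f f, of "-1" 0] by simp
  qed (use test in auto)
  ultimately show ?thesis
    by eventually_elim auto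
qed

lemma weak_derivD:
  assumes "weak_deriv u u'"
  shows "loc_integrable u" "loc_integrable u'"
    and "test_fun \<phi> \<Longrightarrow> (LINT x|lborel. u x * deriv \<phi> x) = - (LINT x|lborel. u' x * \<phi> x)"
  using assms by (simp_all add: weak_deriv_def)

lemma weak_deriv_unique:
  assumes "weak_deriv u u1" "weak_deriv u u2"
  shows "AE x in lborel. u1 x = u2 x"
proof -
  note loc_integrable = weak_derivD(2)[OF assms(1)] weak_derivD(2)[OF assms(2)]
  have "AE x in lborel. 1 * u1 x + (-1) * u2 x = 0"
  proof (rule AE_eq_0_if_test)
    show "loc_integrable (\<lambda>x. 1 * u1 x + (-1) * u2 x)"
      using loc_integrable by (rule loc_integrable_lincomb)
    fix \<phi> assume \<phi>: "test_fun \<phi>"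
    then have "(LINT x|lborel. u1 x * \<phi> x) = (LINT x|lborel. u2 x * \<phi> x)"
      using weak_derivD(3)[OF assms(1)] weak_derivD(3)[OF assms(2)] by fastforce
    then show "(LINT x|lborel. (1 * u1 x + (-1) * u2 x) * \<phi> x) = 0"
      using loc_integrable by (simp add: left_diff_distrib integrable_mult_test_fun \<phi>)
  qed
  then show ?thesis
    by simp
qed

lemma weak_deriv_cong_AE:
  assumes "weak_deriv u u'" "AE x in lborel. u x = w x" "w \<in> borel_measurable lborel"
  shows "weak_deriv w u'"
proof -
  note u = weak_derivD[OF assms(1)]
  have w: "loc_integrable w"
    using u(1) assms(2,3) by (rule loc_integrable_cong_AE)
  have "(LINT x|lborel. u x * deriv \<phi> x) = (LINT x|lborel. w x * deriv \<phi> x)" if "test_fun \<phi>" for \<phi>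
    using assms(2) integrable_mult_test_fun(2)[OF u(1) that] integrable_mult_test_fun(2)[OF w that]
    by (intro integral_cong_AE) auto
  then show ?thesis
    using u w by (simp add: weak_deriv_def)
qed

lemma weak_deriv_lincomb:
  assumes "weak_deriv u u'" "weak_deriv v v'"
  shows "weak_deriv (\<lambda>x. \<alpha> * u x + \<beta> * v x) (\<lambda>x. \<alpha> * u' x + \<beta> * v' x)"
proof -
  note u = weak_derivD[OF assms(1)] and v = weak_derivD[OF assms(2)]
  have "(LINT x|lborel. (\<alpha> * u x + \<beta> * v x) * deriv \<phi> x)
      = - (LINT x|lborel. (\<alpha> * u' x + \<beta> * v' x) * \<phi> x)" if \<phi>: "test_fun \<phi>" for \<phi>
  proof -
    note integrable = integrable_mult_test_fun[OF _ \<phi>]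
    have "(LINT x|lborel. (\<alpha> * u x + \<beta> * v x) * deriv \<phi> x)
        = \<alpha> * (LINT x|lborel. u x * deriv \<phi> x) + \<beta> * (LINT x|lborel. v x * deriv \<phi> x)"
      using integrable(2)[OF u(1)] integrable(2)[OF v(1)] by (simp add: distrib_right mult.assoc)
    also have "\<dots> = - (\<alpha> * (LINT x|lborel. u' x * \<phi> x) + \<beta> * (LINT x|lborel. v' x * \<phi> x))"
      using u(3)[OF \<phi>] v(3)[OF \<phi>] by simp
    also have "\<dots> = - (LINT x|lborel. (\<alpha> * u' x + \<beta> * v' x) * \<phi> x)"
      using integrable(1)[OF u(2)] integrable(1)[OF v(2)] by (simp add: distrib_right mult.assoc)
    finally show ?thesis .
  qed
  then show ?thesis
    using u v by (simp add: weak_deriv_def loc_integrable_lincomb)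
qed

lemma wd_AE_eq:
  assumes "weak_deriv u u'"
  shows "weak_deriv u (wd u)" "AE x in lborel. u' x = wd u x"
proof -
  show "weak_deriv u (wd u)"
    unfolding wd_def using assms by (rule someI[of "weak_deriv u"])
  with assms show "AE x in lborel. u' x = wd u x"
    by (rule weak_deriv_unique)
qed

lemma wd_wd_AE_eq:
  assumes "weak_deriv u u'" "weak_deriv u' u''"
  shows "weak_deriv (wd u) (wd (wd u))" "AE x in lborel. u'' x = wd (wd u) x"
proof -
  have "weak_deriv (wd u) u''"
    using assms(2) wd_AE_eq(2)[OF assms(1)]
      loc_integrable_measurable[OF weak_derivD(2)[OF wd_AE_eq(1)[OF assms(1)]]]
    by (rule weak_deriv_cong_AE)
  then show "weak_deriv (wd u) (wd (wd u))" "AE x in lborel. u'' x = wd (wd u) x"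
    by (fact wd_AE_eq)+
qed

lemma sq_int_iff: "sq_int f \<longleftrightarrow> square_integrable lborel f"
  by (simp add: sq_int_def square_integrable_def)

lemma sq_int_lincomb: "sq_int f \<Longrightarrow> sq_int g \<Longrightarrow> sq_int (\<lambda>x. \<alpha> * f x + \<beta> * g x)"
  using square_integrable_lincomb[of lborel f g \<alpha> \<beta>] by (simp add: sq_int_iff)

lemma H2D:
  assumes "H2 u"
  shows "sq_int u" "sq_int (wd u)" "sq_int (wd (wd u))"
    and "weak_deriv u (wd u)" "weak_deriv (wd u) (wd (wd u))"
proof -
  obtain u' u'' where u: "sq_int u" "sq_int u'" "sq_int u''"
    and weak: "weak_deriv u u'" "weak_deriv u' u''"
    using assms unfolding H2_def by blast
  note wd = wd_AE_eq[OF weak(1)] and wd_wd = wd_wd_AE_eq[OF weak]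
  show "sq_int u" "weak_deriv u (wd u)" "weak_deriv (wd u) (wd (wd u))"
    using u wd wd_wd by auto
  show "sq_int (wd u)" "sq_int (wd (wd u))"
    using u(2,3) wd(2) wd_wd(2) loc_integrable_measurable
      weak_derivD(2)[OF wd(1)] weak_derivD(2)[OF wd_wd(1)]
    unfolding sq_int_iff by (blast intro: square_integrable_cong_AE)+
qed

lemma H2_lincomb:
  assumes "H2 u" "H2 v"
  shows "H2 (\<lambda>x. \<alpha> * u x + \<beta> * v x)"
    and "AE x in lborel. \<alpha> * wd u x + \<beta> * wd v x = wd (\<lambda>x. \<alpha> * u x + \<beta> * v x) x"
    and "AE x in lborel. \<alpha> * wd (wd u) x + \<beta> * wd (wd v) x = wd (wd (\<lambda>x. \<alpha> * u x + \<beta> * v x)) x"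
proof -
  note u = H2D[OF assms(1)] and v = H2D[OF assms(2)]
  note weak = weak_deriv_lincomb[OF u(4) v(4), of \<alpha> \<beta>] weak_deriv_lincomb[OF u(5) v(5), of \<alpha> \<beta>]
  show "H2 (\<lambda>x. \<alpha> * u x + \<beta> * v x)"
    unfolding H2_def using weak sq_int_lincomb[OF u(1) v(1)] sq_int_lincomb[OF u(2) v(2)]
      sq_int_lincomb[OF u(3) v(3)] by blast
  show "AE x in lborel. \<alpha> * wd u x + \<beta> * wd v x = wd (\<lambda>x. \<alpha> * u x + \<beta> * v x) x"
    by (rule wd_AE_eq(2)[OF weak(1)])
  show "AE x in lborel. \<alpha> * wd (wd u) x + \<beta> * wd (wd v) x = wd (wd (\<lambda>x. \<alpha> * u x + \<beta> * v x)) x"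
    by (rule wd_wd_AE_eq(2)[OF weak])
qed

lemma continuous_antiderivative:
  fixes g :: "real \<Rightarrow> real"
  assumes "continuous_on UNIV g"
  obtains \<Phi> where "\<And>x. (\<Phi> has_real_derivative g x) (at x)"
proof -
  have "\<exists>F. \<forall>x::real. -\<infinity> < ereal x \<longrightarrow> ereal x < \<infinity> \<longrightarrow> (F has_vector_derivative g x) (at x)"
    using assms by (intro einterval_antiderivative) (auto simp: continuous_on_eq_continuous_at)
  then show thesis
    using that by (auto simp: has_real_derivative_iff_has_vector_derivative)
qed

lemma lborel_integral_eq_diff_antiderivative:
  fixes g :: "real \<Rightarrow> real"
  assumes "a \<le> b" "continuous_on UNIV g" "\<And>x. x \<notin> {a<..<b} \<Longrightarrow> g x = 0"
    and "\<And>x. x \<in> {a..b} \<Longrightarrow> (\<Phi> has_real_derivative g x) (at x within {a..b})"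
  shows "(LINT x|lborel. g x) = \<Phi> b - \<Phi> a"
proof -
  have "(LINT x|lborel. indicator {a..b} x *\<^sub>R g x) = \<Phi> b - \<Phi> a"
    using assms(1,4) continuous_on_subset[OF assms(2)]
    by (intro integral_FTC_atLeastAtMost) (auto simp: has_real_derivative_iff_has_vector_derivative)
  moreover have "(\<lambda>x. indicator {a..b} x *\<^sub>R g x) = g"
  proof
    show "indicator {a..b} x *\<^sub>R g x = g x" for x
      using assms(3)[of x] by (cases "x \<in> {a<..<b}") auto
  qed
  ultimately show ?thesis
    by simp
qed

lemma bounded_antiderivative_of_nonneg:
  fixes g :: "real \<Rightarrow> real"
  assumes "a \<le> b" and g: "continuous_on UNIV g" "\<And>x. 0 \<le> g x" "\<And>x. x \<notin> {a<..<b} \<Longrightarrow> g x = 0"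
  obtains \<Gamma> where "\<And>x. (\<Gamma> has_real_derivative g x) (at x)" "\<And>x. x \<le> a \<Longrightarrow> \<Gamma> x = 0"
    "\<And>x. x \<ge> b \<Longrightarrow> \<Gamma> x = (LINT x|lborel. g x)" "\<And>x. 0 \<le> \<Gamma> x" "\<And>x. \<Gamma> x \<le> (LINT x|lborel. g x)"
proof -
  obtain \<Phi> where \<Phi>: "\<And>x. (\<Phi> has_real_derivative g x) (at x)"
    using continuous_antiderivative[OF g(1)] by blast
  have mono: "\<Phi> x \<le> \<Phi> y" if "x \<le> y" for x y
    using that by (rule DERIV_nonneg_imp_nondecreasing) (use \<Phi> g(2) in blast)
  have const: "\<Phi> x = \<Phi> y" if "x \<le> y" "\<And>z. x < z \<Longrightarrow> z < y \<Longrightarrow> g z = 0" for x y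
    using MVT2[of x y \<Phi> g] \<Phi> that by (cases "x = y") auto
  have left: "\<Phi> x = \<Phi> a" if "x \<le> a" for x
    using const[of x a] that g(3) by auto
  have right: "\<Phi> x = \<Phi> b" if "b \<le> x" for x
    using const[of b x] that g(3) by auto
  have total: "(LINT x|lborel. g x) = \<Phi> b - \<Phi> a"
    using \<open>a \<le> b\<close> g(1,3) \<Phi> by (intro lborel_integral_eq_diff_antiderivative) (auto intro: DERIV_subset)
  show thesis
  proof (rule that[of "\<lambda>x. \<Phi> x - \<Phi> a"])
    show "((\<lambda>x. \<Phi> x - \<Phi> a) has_real_derivative g x) (at x)" for x
      using DERIV_diff[OF \<Phi> DERIV_const] by simp
    show "\<Phi> x - \<Phi> a = 0" if "x \<le> a" for x
      using left[OF that] by simp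
    show "\<Phi> x - \<Phi> a = (LINT x|lborel. g x)" if "b \<le> x" for x
      using right[OF that] total by simp
    show "0 \<le> \<Phi> x - \<Phi> a" for x
      using left[of "min x a"] mono[of "min x a" x] by simp
    show "\<Phi> x - \<Phi> a \<le> (LINT x|lborel. g x)" for x
      using right[of "max x b"] mono[of x "max x b"] total by simp
  qed
qed

lemma abs_set_integral_mult_le:
  fixes f h :: "'m \<Rightarrow> real"
  assumes f: "set_integrable M A f" and "integrable M (\<lambda>x. f x * h x)"
    and h: "\<And>x. \<bar>h x\<bar> \<le> C * indicator A x"
  shows "\<bar>LINT x|M. f x * h x\<bar> \<le> C * (LINT x:A|M. \<bar>f x\<bar>)"
proof -
  have "\<bar>LINT x|M. f x * h x\<bar> \<le> (LINT x|M. \<bar>f x * h x\<bar>)"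
    by (rule integral_abs_bound)
  also have "\<dots> \<le> (LINT x|M. C * (indicator A x *\<^sub>R \<bar>f x\<bar>))"
  proof (rule integral_mono)
    show "integrable M (\<lambda>x. C * (indicator A x *\<^sub>R \<bar>f x\<bar>))"
      using set_integrable_abs[OF f] by (simp add: set_integrable_def)
    show "\<bar>f x * h x\<bar> \<le> C * (indicator A x *\<^sub>R \<bar>f x\<bar>)" for x
      using mult_left_mono[OF h[of x], of "\<bar>f x\<bar>"] by (simp add: abs_mult mult_ac)
  qed (use assms(2) in simp)
  also have "\<dots> = C * (LINT x:A|M. \<bar>f x\<bar>)"
    by (simp add: set_lebesgue_integral_def)
  finally show ?thesis .
qed

text \<open>Scaling each antiderivative by the total mass of the other weight makes the difference
  compactly supported.\<close>

lemma balanced_test_fun: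
  fixes g h :: "real \<Rightarrow> real"
  defines "m \<equiv> LINT x|lborel. g x" and "n \<equiv> LINT x|lborel. h x"
  assumes "a \<le> b"
    and g: "continuous_on UNIV g" "\<And>x. 0 \<le> g x" "\<And>x. x \<notin> {a<..<b} \<Longrightarrow> g x = 0"
    and h: "continuous_on UNIV h" "\<And>x. 0 \<le> h x" "\<And>x. x \<notin> {a<..<b} \<Longrightarrow> h x = 0"
  obtains \<phi> where "test_fun \<phi>" "deriv \<phi> = (\<lambda>x. n * g x - m * h x)"
    "\<And>x. \<bar>\<phi> x\<bar> \<le> m * n * indicator {a..b} x"
proof -
  obtain \<Gamma> where \<Gamma>: "\<And>x. (\<Gamma> has_real_derivative g x) (at x)" "\<And>x. x \<le> a \<Longrightarrow> \<Gamma> x = 0"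
    "\<And>x. x \<ge> b \<Longrightarrow> \<Gamma> x = m" "\<And>x. 0 \<le> \<Gamma> x" "\<And>x. \<Gamma> x \<le> m"
    unfolding m_def using bounded_antiderivative_of_nonneg[OF \<open>a \<le> b\<close> g] by blast
  obtain H where H: "\<And>x. (H has_real_derivative h x) (at x)" "\<And>x. x \<le> a \<Longrightarrow> H x = 0"
    "\<And>x. x \<ge> b \<Longrightarrow> H x = n" "\<And>x. 0 \<le> H x" "\<And>x. H x \<le> n"
    unfolding n_def using bounded_antiderivative_of_nonneg[OF \<open>a \<le> b\<close> h] by blast
  define \<phi> where "\<phi> x = n * \<Gamma> x - m * H x" for x
  have \<phi>_deriv: "(\<phi> has_real_derivative n * g x - m * h x) (at x)" for x
    unfolding \<phi>_def[abs_def] by (intro DERIV_diff DERIV_cmult \<Gamma>(1) H(1))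
  have \<phi>_outside: "\<phi> x = 0" if "x \<notin> {a..b}" for x
    using that \<Gamma>(2,3)[of x] H(2,3)[of x] by (cases "x \<le> a") (auto simp: \<phi>_def)
  show thesis
  proof
    show "test_fun \<phi>"
      by (rule test_funI[OF \<phi>_deriv _ \<phi>_outside bounded_closed_interval])
        (intro continuous_intros g(1) h(1))
    show "deriv \<phi> = (\<lambda>x. n * g x - m * h x)"
      using DERIV_imp_deriv[OF \<phi>_deriv] by blast
    have "\<bar>\<phi> x\<bar> \<le> m * n" for x
    proof -
      have "0 \<le> n * \<Gamma> x" "n * \<Gamma> x \<le> n * m" "0 \<le> m * H x" "m * H x \<le> m * n"
        using \<Gamma>(4,5)[of x] H(4,5)[of x] by (auto intro!: mult_nonneg_nonneg mult_left_mono)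
      then show ?thesis
        unfolding \<phi>_def mult.commute[of n m] by linarith
    qed
    then show "\<bar>\<phi> x\<bar> \<le> m * n * indicator {a..b} x" for x
      using \<phi>_outside[of x] by (auto simp: indicator_def)
  qed
qed

lemma weak_deriv_mean_diff_le:
  assumes "a \<le> b" and u: "weak_deriv u u'"
    and g: "continuous_on UNIV g" "\<And>x. 0 \<le> g x" "\<And>x. x \<notin> {a<..<b} \<Longrightarrow> g x = 0"
    and h: "continuous_on UNIV h" "\<And>x. 0 \<le> h x" "\<And>x. x \<notin> {a<..<b} \<Longrightarrow> h x = 0"
  shows "\<bar>(LINT x|lborel. h x) * (LINT x|lborel. u x * g x)
      - (LINT x|lborel. g x) * (LINT x|lborel. u x * h x)\<bar>
    \<le> (LINT x|lborel. g x) * (LINT x|lborel. h x) * (LINT x:{a..b}|lborel. \<bar>u' x\<bar>)"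
proof -
  let ?g = "LINT x|lborel. g x" and ?h = "LINT x|lborel. h x"
  obtain \<phi> where \<phi>: "test_fun \<phi>" "deriv \<phi> = (\<lambda>x. ?h * g x - ?g * h x)"
    "\<And>x. \<bar>\<phi> x\<bar> \<le> ?g * ?h * indicator {a..b} x"
    using balanced_test_fun[OF \<open>a \<le> b\<close> g h] by blast
  have "g x = 0" "h x = 0" if "x \<notin> {a..b}" for x
    using g(3)[of x] h(3)[of x] that by auto
  then have integrable: "integrable lborel (\<lambda>x. u x * g x)" "integrable lborel (\<lambda>x. u x * h x)"
    using weak_derivD(1)[OF u] g(1) h(1) by (blast intro: integrable_loc_integrable_mult)+
  have "?h * (LINT x|lborel. u x * g x) - ?g * (LINT x|lborel. u x * h x)
      = (LINT x|lborel. ?h * (u x * g x) - ?g * (u x * h x))"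
    using integrable by simp
  also have "\<dots> = (LINT x|lborel. u x * deriv \<phi> x)"
    by (simp add: \<phi>(2) right_diff_distrib mult.left_commute)
  also have "\<dots> = - (LINT x|lborel. u' x * \<phi> x)"
    by (rule weak_derivD(3)[OF u \<phi>(1)])
  finally have "\<bar>?h * (LINT x|lborel. u x * g x) - ?g * (LINT x|lborel. u x * h x)\<bar>
      = \<bar>LINT x|lborel. u' x * \<phi> x\<bar>"
    by (simp only: abs_minus_cancel)
  also have "\<dots> \<le> ?g * ?h * (LINT x:{a..b}|lborel. \<bar>u' x\<bar>)"
    using loc_integrableD[OF weak_derivD(2)[OF u]]
      integrable_mult_test_fun(1)[OF weak_derivD(2)[OF u] \<phi>(1)] \<phi>(3)
    by (rule abs_set_integral_mult_le)
  finally show ?thesis .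
qed

definition parabola :: "real \<Rightarrow> real \<Rightarrow> real" where
  "parabola a x = 6 * max 0 ((x - a) * (a + 1 - x))"

lemma continuous_parabola: "continuous_on UNIV (parabola a)"
  unfolding parabola_def[abs_def] by (intro continuous_intros)

lemma parabola_nonneg: "0 \<le> parabola a x"
  by (simp add: parabola_def)

lemma parabola_eq_0:
  assumes "x \<notin> {a<..<a+1}"
  shows "parabola a x = 0"
proof -
  have "(x - a) * (a + 1 - x) \<le> 0"
    using assms by (cases "x \<le> a") (auto intro: mult_nonpos_nonneg mult_nonneg_nonpos)
  then show ?thesis
    by (simp add: parabola_def)
qed

lemma abs_parabola_le: "\<bar>parabola a x\<bar> \<le> 3/2 * indicator {a..a+1} x"
proof (cases "x \<in> {a<..<a+1}")
  case True
  have "0 \<le> (2 * (x - a) - 1)\<^sup>2"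
    by simp
  then have "(x - a) * (a + 1 - x) \<le> 1/4"
    by (simp add: power2_eq_square algebra_simps)
  with True show ?thesis
    by (simp add: parabola_def)
qed (simp add: parabola_eq_0)

lemma integral_parabola: "(LINT x|lborel. parabola a x) = 1"
proof -
  let ?H = "\<lambda>x. 3 * (x - a)\<^sup>2 - 2 * (x - a)^3"
  have "(LINT x|lborel. parabola a x) = ?H (a + 1) - ?H a"
  proof (rule lborel_integral_eq_diff_antiderivative[where \<Phi> = ?H,
      OF _ continuous_parabola parabola_eq_0])
    fix x assume "x \<in> {a..a+1}"
    then have "parabola a x = 6 * ((x - a) * (a + 1 - x))"
      by (simp add: parabola_def)
    then show "(?H has_real_derivative parabola a x) (at x within {a..a+1})"
      by (auto intro!: derivative_eq_intros simp: power2_eq_square algebra_simps)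
  qed auto
  then show ?thesis
    by simp
qed

definition local_W11_bound :: "real \<Rightarrow> (real \<Rightarrow> real) \<Rightarrow> (real \<Rightarrow> real) \<Rightarrow> real" where
  "local_W11_bound a u u' = 3/2 * (LINT x:{a..a+1}|lborel. \<bar>u x\<bar>) + (LINT x:{a..a+1}|lborel. \<bar>u' x\<bar>)"

lemma integral_mult_test_le:
  assumes u: "weak_deriv u u'"
    and g: "test_fun g" "\<And>x. 0 \<le> g x" "\<And>x. x \<notin> {a<..<a+1} \<Longrightarrow> g x = 0"
  shows "\<bar>LINT x|lborel. u x * g x\<bar> \<le> local_W11_bound a u u' * (LINT x|lborel. g x)"
proof -
  let ?g = "LINT x|lborel. g x"
  let ?\<eta> = "parabola a"
  have "integrable lborel (\<lambda>x. u x * ?\<eta> x)"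
    by (rule integrable_loc_integrable_mult[OF weak_derivD(1)[OF u] continuous_parabola, of a "a+1"])
      (auto intro!: parabola_eq_0)
  then have weighted_mean_le: "\<bar>LINT x|lborel. u x * ?\<eta> x\<bar> \<le> 3/2 * (LINT x:{a..a+1}|lborel. \<bar>u x\<bar>)"
    by (rule abs_set_integral_mult_le[OF loc_integrableD[OF weak_derivD(1)[OF u]] _ abs_parabola_le])
  have "0 \<le> ?g"
    using g(2) by (intro integral_nonneg_AE) simp
  have "\<bar>(LINT x|lborel. u x * g x) - ?g * (LINT x|lborel. u x * ?\<eta> x)\<bar>
      \<le> ?g * (LINT x:{a..a+1}|lborel. \<bar>u' x\<bar>)"
    using weak_deriv_mean_diff_le[OF _ u test_fun_continuous(1)[OF g(1)] g(2,3)
      continuous_parabola parabola_nonneg parabola_eq_0, of a]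
    by (simp add: integral_parabola)
  moreover have "\<bar>?g * (LINT x|lborel. u x * ?\<eta> x)\<bar> \<le> ?g * (3/2 * (LINT x:{a..a+1}|lborel. \<bar>u x\<bar>))"
    unfolding abs_mult abs_of_nonneg[OF \<open>0 \<le> ?g\<close>]
    using weighted_mean_le \<open>0 \<le> ?g\<close> by (rule mult_left_mono)
  ultimately show ?thesis
    by (simp add: local_W11_bound_def algebra_simps)
qed

lemma AE_abs_le_local_W11_bound:
  assumes u: "weak_deriv u u'"
  shows "AE x in lborel. x \<in> {a<..<a+1} \<longrightarrow> \<bar>u x\<bar> \<le> local_W11_bound a u u'"
proof -
  define m where "m = local_W11_bound a u u'"
  note loc_integrable = loc_integrable_const[of m] weak_derivD(1)[OF u]
  have one_sided: "AE x in lborel. x \<in> {a<..<a+1} \<longrightarrow> 0 \<le> m + s * u x" if "\<bar>s\<bar> = 1" for s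
  proof (rule AE_nonneg_if_test)
    show "loc_integrable (\<lambda>x. m + s * u x)"
      using loc_integrable_lincomb[OF loc_integrable, of 1 s] by simp
    fix g assume g: "test_fun g" "\<And>x. 0 \<le> g x" "\<And>x. x \<notin> {a<..<a+1} \<Longrightarrow> g x = 0"
    have "(LINT x|lborel. (m + s * u x) * g x) = (LINT x|lborel. m * g x + s * (u x * g x))"
      by (simp add: distrib_right mult.assoc)
    also have "\<dots> = m * (LINT x|lborel. g x) + s * (LINT x|lborel. u x * g x)"
      by (simp only: Bochner_Integration.integral_add integrable_mult_right integral_mult_right_zero
          integrable_mult_test_fun(1)[OF loc_integrable(1) g(1)]
          integrable_mult_test_fun(1)[OF loc_integrable(2) g(1)])
    finally have "(LINT x|lborel. (m + s * u x) * g x)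
        = m * (LINT x|lborel. g x) + s * (LINT x|lborel. u x * g x)" .
    moreover have "\<bar>s * (LINT x|lborel. u x * g x)\<bar> \<le> m * (LINT x|lborel. g x)"
      unfolding abs_mult that m_def using integral_mult_test_le[OF u g] by simp
    ultimately show "0 \<le> (LINT x|lborel. (m + s * u x) * g x)"
      by linarith
  qed simp
  from one_sided[of 1, simplified] one_sided[of "-1", simplified] show ?thesis
    unfolding m_def by eventually_elim auto
qed

lemma set_integral_abs_le_L2_norm:
  assumes "sq_int f"
  shows "(LINT x:{a..a+1}|lborel. \<bar>f x\<bar>) \<le> sqrt (LINT x|lborel. (f x)\<^sup>2)"
proof -
  let ?I = "{a..a+1}"
  let ?m = "LINT x:?I|lborel. \<bar>f x\<bar>"
  have f [measurable]: "f \<in> borel_measurable borel"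
    and integrable_square: "integrable lborel (\<lambda>x. (f x)\<^sup>2)"
    using assms by (auto simp: sq_int_def)
  have integrable_indicator: "integrable lborel (indicator ?I :: real \<Rightarrow> real)"
    "(LINT x|lborel. indicator ?I x :: real) = 1"
    by (auto simp: emeasure_lborel_Icc_eq)
  have square: "integrable lborel (\<lambda>x. indicator ?I x * (f x)\<^sup>2)"
    using integrable_mult_indicator[OF _ integrable_square, of ?I] by simp
  have indicator_square: "(indicator ?I x)\<^sup>2 = (indicator ?I x :: real)" for x
    by (simp add: indicator_def)
  have "square_integrable lborel (indicator ?I :: real \<Rightarrow> real)" "square_integrable lborel (\<lambda>x. \<bar>f x\<bar>)"
    using integrable_indicator(1) integrable_square
    by (simp_all add: square_integrable_def indicator_square)
  then have abs: "integrable lborel (\<lambda>x. indicator ?I x * \<bar>f x\<bar>)"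
    by (rule integrable_bilinear[OF bounded_bilinear_mult])
  have "0 \<le> (LINT x|lborel. indicator ?I x * (\<bar>f x\<bar> - ?m)\<^sup>2)"
    by (intro integral_nonneg_AE) auto
  also have "\<dots> = (LINT x|lborel. indicator ?I x * (f x)\<^sup>2
      - 2 * ?m * (indicator ?I x * \<bar>f x\<bar>) + ?m\<^sup>2 * indicator ?I x)"
    by (intro Bochner_Integration.integral_cong) (auto simp: power2_eq_square algebra_simps)
  also have "\<dots> = (LINT x|lborel. indicator ?I x * (f x)\<^sup>2) - 2 * ?m * ?m + ?m\<^sup>2"
    using square abs integrable_indicator by (simp add: set_lebesgue_integral_def)
  finally have "?m\<^sup>2 \<le> (LINT x|lborel. indicator ?I x * (f x)\<^sup>2)"
    by (simp add: power2_eq_square)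
  also have "\<dots> \<le> (LINT x|lborel. (f x)\<^sup>2)"
    using square integrable_square by (intro integral_mono) (auto simp: indicator_def)
  finally show ?thesis
    by (rule real_le_rsqrt)
qed

lemma H1_ess_bound:
  assumes weak: "weak_deriv u u'" and u: "sq_int u" "sq_int u'"
  shows "AE x in lborel. \<bar>u x\<bar> \<le> 5/2 * sqrt ((LINT x|lborel. (u x)\<^sup>2) + (LINT x|lborel. (u' x)\<^sup>2))"
proof -
  let ?N = "sqrt ((LINT x|lborel. (u x)\<^sup>2) + (LINT x|lborel. (u' x)\<^sup>2))"
  have "(LINT x:{a..a+1}|lborel. \<bar>u x\<bar>) \<le> ?N" "(LINT x:{a..a+1}|lborel. \<bar>u' x\<bar>) \<le> ?N" for a
    using set_integral_abs_le_L2_norm[OF u(1), of a] set_integral_abs_le_L2_norm[OF u(2), of a]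
    by (auto elim!: order_trans)
  then have "local_W11_bound a u u' \<le> 3/2 * ?N + ?N" for a
    unfolding local_W11_bound_def by (intro add_mono mult_left_mono) auto
  then have bound: "local_W11_bound a u u' \<le> 5/2 * ?N" for a
    by simp
  have "AE x in lborel. x \<in> {a<..<a+1} \<longrightarrow> \<bar>u x\<bar> \<le> 5/2 * ?N" for a
    using AE_abs_le_local_W11_bound[OF weak, of a] by eventually_elim (use bound[of a] in linarith)
  then have "AE x in lborel. \<forall>r::rat. x \<in> {of_rat r<..<of_rat r + 1} \<longrightarrow> \<bar>u x\<bar> \<le> 5/2 * ?N"
    unfolding AE_all_countable by blast
  then show ?thesis
  proof eventually_elim
    case (elim x)
    obtain r where "x - 1 < of_rat r" "of_rat r < x"
      using of_rat_dense[of "x - 1" x] by auto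
    then have "x \<in> {of_rat r<..<of_rat r + 1}"
      by simp
    with elim show ?case
      by blast
  qed
qed

section \<open>Superquadratic potentials\<close>

lemma has_real_derivative_along_ray:
  assumes "(f has_derivative D) (at (s *\<^sub>R w))"
  shows "((\<lambda>s. f (s *\<^sub>R w)) has_real_derivative D w) (at s)"
proof -
  have "((\<lambda>s. f (s *\<^sub>R w)) has_derivative (\<lambda>h. D (h *\<^sub>R w))) (at s)"
    by (rule has_derivative_compose[where f = "\<lambda>s. s *\<^sub>R w" and g = f, OF _ assms])
      (auto intro!: derivative_eq_intros)
  moreover have "D (h *\<^sub>R w) = D w * h" for h
    using linear_scale[OF has_derivative_linear[OF assms]] by (simp add: mult.commute)
  ultimately show ?thesis
    by (simp add: has_field_derivative_def)
qed

lemma superhomogeneous_if_Euler_inequality: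
  fixes f :: "'a::real_normed_vector \<Rightarrow> real"
  assumes f: "\<And>x. (f has_derivative D x) (at x)" and Euler: "\<And>x. k * f x \<le> D x x" and t: "1 \<le> t"
  shows "t powr k * f w \<le> f (t *\<^sub>R w)"
proof -
  define g where "g s = f (s *\<^sub>R w) * s powr (- k)" for s
  have "g 1 \<le> g t"
  proof (rule DERIV_nonneg_imp_nondecreasing[OF t])
    fix s assume "1 \<le> s" "s \<le> t"
    then have s: "0 < s"
      by simp
    have "(g has_real_derivative D (s *\<^sub>R w) w * s powr (- k) + (- k * s powr (- k - 1)) * f (s *\<^sub>R w))
        (at s)"
      unfolding g_def[abs_def] using s
      by (intro DERIV_mult has_real_derivative_along_ray f) (auto intro!: derivative_eq_intros)
    moreover have "D (s *\<^sub>R w) w * s powr (- k) + (- k * s powr (- k - 1)) * f (s *\<^sub>R w)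
        = s powr (- k - 1) * (D (s *\<^sub>R w) (s *\<^sub>R w) - k * f (s *\<^sub>R w))"
    proof -
      have "s powr (- k) = s powr (- k - 1) * s"
        using s powr_add[of s "- k - 1" 1] by simp
      moreover have "D (s *\<^sub>R w) (s *\<^sub>R w) = s * D (s *\<^sub>R w) w"
        using linear_scale[OF has_derivative_linear[OF f]] by simp
      ultimately show ?thesis
        by (simp add: algebra_simps)
    qed
    moreover have "0 \<le> s powr (- k - 1) * (D (s *\<^sub>R w) (s *\<^sub>R w) - k * f (s *\<^sub>R w))"
      using Euler[of "s *\<^sub>R w"] by (intro mult_nonneg_nonneg) auto
    ultimately show "\<exists>y. (g has_real_derivative y) (at s) \<and> 0 \<le> y"
      by metis
  qed
  then have "f w \<le> f (t *\<^sub>R w) / t powr k"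
    by (simp add: g_def powr_minus divide_inverse)
  then show ?thesis
    using t by (simp add: field_simps)
qed

lemma lipschitz_gradient_remainder:
  fixes F :: "'a::real_inner \<Rightarrow> real"
  assumes F: "\<And>x. (F has_derivative (\<lambda>h. DF x \<bullet> h)) (at x)"
    and lipschitz: "L-lipschitz_on (closed_segment w (w + h)) DF"
  shows "\<bar>F (w + h) - F w - DF w \<bullet> h\<bar> \<le> L * (norm h)\<^sup>2"
proof -
  let ?f = "\<lambda>x. F x - DF w \<bullet> x"
  have "norm (?f (w + h) - ?f w) \<le> (L * norm h) * norm (w + h - w)"
  proof (rule differentiable_bound[OF convex_closed_segment])
    fix x assume x: "x \<in> closed_segment w (w + h)"
    show "(?f has_derivative (\<lambda>k. (DF x - DF w) \<bullet> k)) (at x within closed_segment w (w + h))"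
      by (rule has_derivative_at_withinI) (auto intro!: derivative_eq_intros F simp: inner_diff_left)
    have "norm (DF x - DF w) \<le> L * norm (x - w)"
      by (rule lipschitz_on_normD[OF lipschitz x]) simp
    also have "\<dots> \<le> L * norm h"
      using segment_bound1[OF x] lipschitz_on_nonneg[OF lipschitz] by (intro mult_left_mono) auto
    finally have "norm (DF x - DF w) \<le> L * norm h" .
    then have "\<bar>(DF x - DF w) \<bullet> k\<bar> \<le> L * norm h * norm k" for k
      by (meson Cauchy_Schwarz_ineq2 mult_right_mono norm_ge_zero order_trans)
    then show "onorm (\<lambda>k. (DF x - DF w) \<bullet> k) \<le> L * norm h"
      using lipschitz_on_nonneg[OF lipschitz] by (intro onorm_bound) auto
  qed auto
  then show ?thesis
    by (simp add: inner_right_distrib power2_eq_square algebra_simps)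
qed

lemma powr_Bernoulli:
  fixes r x :: real
  assumes "1 \<le> r" "0 < x"
  shows "r * (x - 1) \<le> x powr r - 1"
proof -
  have "((\<lambda>x. x powr r) has_real_derivative r) (at 1)"
    by (auto intro!: derivative_eq_intros)
  then have "x powr r - 1 powr r \<ge> r * (x - 1)"
    using assms
    by (intro convex_on_imp_above_tangent[OF powr_convex]) (auto simp: interior_open intro: DERIV_subset)
  then show ?thesis
    by simp
qed

locale superquadratic =
  fixes F :: "'a::euclidean_space \<Rightarrow> real" and DF :: "'a \<Rightarrow> 'a" and p :: real
  assumes F_0: "F 0 = 0"
    and F_has_derivative: "(F has_derivative (\<lambda>h. DF w \<bullet> h)) (at w)"
    and DF_lipschitz: "\<exists>L. L-lipschitz_on (cball 0 R) DF"
    and p_pos: "0 < p"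
    and scaling: "1 \<le> t \<Longrightarrow> t powr (p + 2) * (w \<bullet> DF w) \<le> (t *\<^sub>R w) \<bullet> DF (t *\<^sub>R w)"
begin

definition G :: "'a \<Rightarrow> real" where
  "G w = w \<bullet> DF w"

lemma G_scale_ge: "1 \<le> t \<Longrightarrow> t powr (p + 2) * G w \<le> G (t *\<^sub>R w)"
  unfolding G_def by (rule scaling)

lemma G_scale_le:
  assumes "0 < t" "t \<le> 1"
  shows "G (t *\<^sub>R w) \<le> t powr (p + 2) * G w"
proof -
  have "(1/t) powr (p + 2) * G (t *\<^sub>R w) \<le> G w"
    using G_scale_ge[of "1/t" "t *\<^sub>R w"] assms by simp
  then show ?thesis
    using assms by (simp add: powr_divide field_simps)
qed

lemma F_continuous: "continuous_on UNIV F"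
  by (intro continuous_at_imp_continuous_on ballI has_derivative_continuous[OF F_has_derivative])

lemma DF_continuous: "continuous_on UNIV DF"
proof (rule continuous_at_imp_continuous_on, intro ballI)
  fix w :: 'a
  obtain L where "L-lipschitz_on (cball 0 (norm w + 1)) DF"
    using DF_lipschitz by blast
  then have "continuous_on (ball 0 (norm w + 1)) DF"
    by (rule continuous_on_subset[OF lipschitz_on_continuous_on ball_subset_cball])
  then show "isCont DF w"
    by (auto simp: continuous_on_eq_continuous_at)
qed

text \<open>Superquadratic growth of \<open>G\<close> along rays excludes a linear part of \<open>F\<close> at the origin.\<close>

lemma DF_0: "DF 0 = 0"
proof -
  have le: "DF (t *\<^sub>R DF 0) \<bullet> DF 0 \<le> t powr (p + 1) * G (DF 0)" if "0 < t" "t < 1" for t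
  proof -
    have "t powr (p + 2) = t * t powr (p + 1)"
      using powr_add[of t 1 "p + 1"] that by (simp add: add.commute)
    then have "t * (DF (t *\<^sub>R DF 0) \<bullet> DF 0) \<le> t * (t powr (p + 1) * G (DF 0))"
      using G_scale_le[of t "DF 0"] that by (simp add: G_def inner_commute mult.assoc)
    then show ?thesis
      using that by simp
  qed
  have "((\<lambda>t. t powr (p + 1)) \<longlongrightarrow> 0) (at_right 0)"
    by (rule tendsto_zero_powrI[OF _ tendsto_const]) (use p_pos in \<open>auto simp: eventually_at_filter\<close>)
  then have rhs: "((\<lambda>t. t powr (p + 1) * G (DF 0)) \<longlongrightarrow> 0) (at_right 0)"
    by (rule tendsto_mult_left_zero)
  have "((\<lambda>t. t *\<^sub>R DF 0) \<longlongrightarrow> 0 *\<^sub>R DF 0) (at_right 0)"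
    by (intro tendsto_scaleR tendsto_ident_at tendsto_const)
  then have "((\<lambda>t. DF (t *\<^sub>R DF 0)) \<longlongrightarrow> DF (0 *\<^sub>R DF 0)) (at_right 0)"
    by (rule continuous_on_tendsto_compose[OF DF_continuous]) auto
  then have lhs: "((\<lambda>t. DF (t *\<^sub>R DF 0) \<bullet> DF 0) \<longlongrightarrow> DF 0 \<bullet> DF 0) (at_right 0)"
    using tendsto_inner[OF _ tendsto_const] by simp
  have "\<forall>\<^sub>F t in at_right 0. DF (t *\<^sub>R DF 0) \<bullet> DF 0 \<le> t powr (p + 1) * G (DF 0)"
    using le by (intro eventually_at_rightI[of 0 1]) auto
  then have "DF 0 \<bullet> DF 0 \<le> 0"
    by (rule tendsto_le[OF trivial_limit_at_right_real rhs lhs])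
  then show ?thesis
    using inner_gt_zero_iff[of "DF 0"] by linarith
qed

lemma DF_bound:
  assumes "0 \<le> R"
  shows "\<exists>C\<ge>0. \<forall>w. norm w \<le> R \<longrightarrow> norm (DF w) \<le> C * norm w"
proof -
  obtain L where "L-lipschitz_on (cball 0 R) DF"
    using DF_lipschitz by blast
  then show ?thesis
    using lipschitz_on_normD[of L "cball 0 R" DF _ 0] lipschitz_on_nonneg assms
    by (intro exI[of _ L]) (auto simp: DF_0)
qed

lemma F_remainder:
  assumes "0 \<le> R"
  shows "\<exists>C\<ge>0. \<forall>w h. norm w \<le> R \<longrightarrow> norm h \<le> R \<longrightarrow> \<bar>F (w + h) - F w - DF w \<bullet> h\<bar> \<le> C * (norm h)\<^sup>2"
proof -
  obtain L where L: "L-lipschitz_on (cball 0 (2 * R)) DF"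
    using DF_lipschitz by blast
  have "\<bar>F (w + h) - F w - DF w \<bullet> h\<bar> \<le> L * (norm h)\<^sup>2" if "norm w \<le> R" "norm h \<le> R" for w h
  proof (rule lipschitz_gradient_remainder[OF F_has_derivative lipschitz_on_subset[OF L]])
    have "w \<in> cball 0 (2 * R)" "w + h \<in> cball 0 (2 * R)"
      using that assms norm_triangle_ineq[of w h] by auto
    then show "closed_segment w (w + h) \<subseteq> cball 0 (2 * R)"
      by (rule closed_segment_subset) (rule convex_cball)
  qed
  with lipschitz_on_nonneg[OF L] show ?thesis
    by blast
qed

lemma F_bound:
  assumes "0 \<le> R"
  shows "\<exists>C\<ge>0. \<forall>w. norm w \<le> R \<longrightarrow> \<bar>F w\<bar> \<le> C * (norm w)\<^sup>2"
proof -
  obtain C where C: "0 \<le> C"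
    "\<And>w h. norm w \<le> R \<Longrightarrow> norm h \<le> R \<Longrightarrow> \<bar>F (w + h) - F w - DF w \<bullet> h\<bar> \<le> C * (norm h)\<^sup>2"
    using F_remainder[OF assms] by blast
  have "\<bar>F w\<bar> \<le> C * (norm w)\<^sup>2" if "norm w \<le> R" for w
    using C(2)[of 0 w] that assms by (simp add: F_0 DF_0)
  with C(1) show ?thesis
    by blast
qed

lemma G_bound:
  assumes "0 \<le> R"
  shows "\<exists>C\<ge>0. \<forall>w. norm w \<le> R \<longrightarrow> \<bar>G w\<bar> \<le> C * (norm w)\<^sup>2"
proof -
  obtain C where C: "0 \<le> C" "\<And>w. norm w \<le> R \<Longrightarrow> norm (DF w) \<le> C * norm w"
    using DF_bound[OF assms] by blast
  have "\<bar>G w\<bar> \<le> C * (norm w)\<^sup>2" if "norm w \<le> R" for w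
  proof -
    have "\<bar>G w\<bar> \<le> norm w * norm (DF w)"
      unfolding G_def by (rule Cauchy_Schwarz_ineq2)
    also have "\<dots> \<le> norm w * (C * norm w)"
      using C(2)[OF that] by (rule mult_left_mono) simp
    finally show ?thesis
      by (simp add: power2_eq_square mult_ac)
  qed
  with C(1) show ?thesis
    by blast
qed

lemma F_ray_has_derivative:
  assumes s: "0 < s"
  shows "((\<lambda>s. F (s *\<^sub>R w) - G w * (s powr (p + 2) / (p + 2))) has_real_derivative
    (G (s *\<^sub>R w) - s powr (p + 2) * G w) / s) (at s)"
proof -
  have "((\<lambda>s. G w * (s powr (p + 2) / (p + 2))) has_real_derivative G w * s powr (p + 1)) (at s)"
    using s p_pos by (auto intro!: derivative_eq_intros simp: add.commute)
  then have "((\<lambda>s. F (s *\<^sub>R w) - G w * (s powr (p + 2) / (p + 2))) has_real_derivative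
      DF (s *\<^sub>R w) \<bullet> w - G w * s powr (p + 1)) (at s)"
    by (rule DERIV_diff[OF has_real_derivative_along_ray[OF F_has_derivative]])
  moreover have "s powr (p + 2) = s powr (p + 1) * s"
    using powr_add[of s "p + 1" 1] s by (simp add: add.assoc)
  then have "DF (s *\<^sub>R w) \<bullet> w - G w * s powr (p + 1) = (G (s *\<^sub>R w) - s powr (p + 2) * G w) / s"
    using s by (simp add: G_def[of "s *\<^sub>R w"] inner_commute[of w] diff_divide_distrib mult.commute)
  ultimately show ?thesis
    by simp
qed

lemma F_scale_ge:
  assumes "0 \<le> t"
  shows "G w * ((t powr (p + 2) - 1) / (p + 2)) \<le> F (t *\<^sub>R w) - F w"
proof -
  let ?f = "\<lambda>s. F (s *\<^sub>R w) - G w * (s powr (p + 2) / (p + 2))"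
  have continuous: "continuous_on {r..s} ?f" if "0 \<le> r" for r s
    using p_pos that
    by (intro continuous_on_diff continuous_on_mult continuous_on_divide
      continuous_on_const continuous_on_scaleR
        continuous_on_id continuous_on_compose2[OF F_continuous] continuous_on_powr') auto
  have "?f 1 \<le> ?f t"
  proof (cases "t \<le> 1")
    case True
    then show ?thesis
    proof (rule DERIV_nonpos_imp_decreasing_open[where f = ?f])
      fix s assume "t < s" "s < 1"
      with assms have "0 < s" "(G (s *\<^sub>R w) - s powr (p + 2) * G w) / s \<le> 0"
        using G_scale_le[of s w] by (auto intro: divide_nonpos_pos)
      with F_ray_has_derivative show "\<exists>y. (?f has_real_derivative y) (at s) \<and> y \<le> 0"
        by blast
    qed (rule continuous[OF assms])
  next
    case False
    then have "1 \<le> t"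
      by simp
    then show ?thesis
    proof (rule DERIV_nonneg_imp_increasing_open[where f = ?f])
      fix s assume "1 < s" "s < t"
      then have "0 < s" "0 \<le> (G (s *\<^sub>R w) - s powr (p + 2) * G w) / s"
        using G_scale_ge[of s w] by auto
      with F_ray_has_derivative show "\<exists>y. (?f has_real_derivative y) (at s) \<and> 0 \<le> y"
        by blast
    qed (rule continuous, simp)
  qed
  then show ?thesis
    by (simp add: right_diff_distrib diff_divide_distrib)
qed

lemma F_le_G: "F w \<le> G w / (p + 2)"
  using F_scale_ge[of 0 w] by (simp add: F_0)

end

section \<open>Minimisation on the Nehari manifold\<close>

lemma has_real_derivative_if_quadratic_remainder:
  fixes f :: "real \<Rightarrow> real"
  assumes "0 < d" and remainder: "\<And>s. \<bar>s\<bar> < d \<Longrightarrow> \<bar>f (x + s) - f x - s * D\<bar> \<le> C * s\<^sup>2"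
  shows "(f has_real_derivative D) (at x)"
  unfolding DERIV_def
proof (rule tendsto_rabs_zero_cancel[THEN Lim_null[THEN iffD2]], rule Lim_null_comparison)
  show "\<forall>\<^sub>F s in at 0. norm \<bar>(f (x + s) - f x) / s - D\<bar> \<le> C * \<bar>s\<bar>"
    unfolding eventually_at
  proof (intro exI[of _ d] conjI ballI impI \<open>0 < d\<close>)
    fix s :: real assume s: "s \<noteq> 0 \<and> dist s 0 < d"
    then have "(f (x + s) - f x) / s - D = (f (x + s) - f x - s * D) / s"
      by (simp add: field_simps)
    also have "\<bar>\<dots>\<bar> \<le> C * s\<^sup>2 / \<bar>s\<bar>"
      using remainder[of s] s by (simp add: divide_right_mono)
    also have "\<dots> = C * \<bar>s\<bar>"
      using s by (cases "0 \<le> s") (simp_all add: power2_eq_square)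
    finally show "norm \<bar>(f (x + s) - f x) / s - D\<bar> \<le> C * \<bar>s\<bar>"
      by simp
  qed
  show "((\<lambda>s. C * \<bar>s\<bar>) \<longlongrightarrow> 0) (at 0)"
    by (auto intro!: tendsto_eq_intros)
qed

lemma open_contains_rectangle:
  fixes x y :: real
  assumes "open V" "(x, y) \<in> V"
  obtains r where "0 < r" "\<And>s t. \<bar>s - x\<bar> \<le> r \<Longrightarrow> \<bar>t - y\<bar> \<le> r \<Longrightarrow> (s, t) \<in> V"
proof -
  obtain S T where "open S" "open T" "(x, y) \<in> S \<times> T" and subset: "S \<times> T \<subseteq> V"
    by (rule open_prod_elim[OF assms])
  then have "x \<in> S" "y \<in> T"
    by simp_all
  obtain r where r: "0 < r" "cball x r \<subseteq> S"
    using \<open>open S\<close> \<open>x \<in> S\<close> unfolding open_contains_cball by blast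
  obtain r' where r': "0 < r'" "cball y r' \<subseteq> T"
    using \<open>open T\<close> \<open>y \<in> T\<close> unfolding open_contains_cball by blast
  show thesis
  proof (rule that[of "min r r'"])
    fix s t assume "\<bar>s - x\<bar> \<le> min r r'" "\<bar>t - y\<bar> \<le> min r r'"
    then have "s \<in> cball x r" "t \<in> cball y r'"
      by (auto simp: dist_real_def abs_minus_commute)
    with r(2) r'(2) subset show "(s, t) \<in> V"
      by blast
  qed (use r(1) r'(1) in simp)
qed

lemma zero_after_small_step:
  fixes P :: "real \<times> real \<Rightarrow> real"
  assumes P: "continuous_on UNIV P" "0 < P (x, 0)" "P (y, 0) < 0" and "x \<le> y" "0 < r"
  obtains s t where "0 < s" "s < r" "x \<le> t" "t \<le> y" "P (t, s) = 0"
proof -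
  have P_tendsto: "((\<lambda>s. P (t, s)) \<longlongrightarrow> P (t, 0)) (at_right 0)" for t
    by (rule continuous_on_tendsto_compose[OF P(1)]) (auto intro!: tendsto_eq_intros)
  have "\<forall>\<^sub>F s in at_right 0. 0 < P (x, s)"
    using P(2) by (rule order_tendstoD(1)[OF P_tendsto])
  moreover have "\<forall>\<^sub>F s in at_right 0. P (y, s) < 0"
    using P(3) by (rule order_tendstoD(2)[OF P_tendsto])
  moreover have "\<forall>\<^sub>F s in at_right 0. s \<in> {0<..<r}"
    using \<open>0 < r\<close> by (rule eventually_at_right_real)
  ultimately have "\<forall>\<^sub>F s in at_right 0. 0 < P (x, s) \<and> P (y, s) < 0 \<and> s \<in> {0<..<r}"
    by eventually_elim blast
  then obtain s where s: "0 < P (x, s)" "P (y, s) < 0" "0 < s" "s < r"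
    using eventually_happens'[OF trivial_limit_at_right_real] by fastforce
  have "continuous_on {x..y} (\<lambda>t. P (t, s))"
    by (intro continuous_on_compose2[OF P(1)] continuous_intros) auto
  then obtain t where "x \<le> t" "t \<le> y" "P (t, s) = 0"
    using IVT2'[of "\<lambda>t. P (t, s)" y 0 x] s(1,2) \<open>x \<le> y\<close> by auto
  with s(3,4) show thesis
    by (intro that)
qed

text \<open>The first coordinate runs along the ray through the minimiser, the second in a descent
  direction: after a small step in the second coordinate, the constraint is restored by adjusting
  the first, at no cost because \<open>J\<close> is maximal on the ray at \<open>(1, 0)\<close>.\<close>

lemma constrained_descent_in_plane:
  fixes J J' P :: "real \<times> real \<Rightarrow> real"
  assumes P: "continuous_on UNIV P" "\<And>t. 0 < t \<Longrightarrow> t < 1 \<Longrightarrow> 0 < P (t, 0)" "\<And>t. 1 < t \<Longrightarrow> P (t, 0) < 0"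
    and J_ray: "\<And>t. 0 < t \<Longrightarrow> J (t, 0) \<le> J (1, 0)"
    and J_deriv: "\<And>t s. ((\<lambda>s. J (t, s)) has_real_derivative J' (t, s)) (at s)"
    and J': "continuous_on UNIV J'" "J' (1, 0) < 0"
    and U: "open U" "(1, 0) \<in> U"
  obtains z where "z \<in> U" "P z = 0" "J z < J (1, 0)"
proof -
  have "open (U \<inter> {z. J' z < 0})"
    using U(1) J'(1) by (intro open_Int open_Collect_less continuous_on_const) auto
  then obtain d where d: "0 < d" "\<And>t s. \<bar>t - 1\<bar> \<le> d \<Longrightarrow> \<bar>s - 0\<bar> \<le> d \<Longrightarrow> (t, s) \<in> U \<inter> {z. J' z < 0}"
    using open_contains_rectangle[of "U \<inter> {z. J' z < 0}" 1 0] U(2) J'(2) by blast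
  define r where "r = min d (1/2)"
  have r: "0 < r" "r < 1" "r \<le> d"
    using d(1) by (auto simp: r_def)
  obtain s t where st: "0 < s" "s < r" "1 - r \<le> t" "t \<le> 1 + r" "P (t, s) = 0"
    by (rule zero_after_small_step[OF P(1) P(2)[of "1 - r"] P(3)[of "1 + r"] _ r(1)]) (use r in auto)
  have near: "(t, y) \<in> U" "J' (t, y) < 0" if "0 \<le> y" "y \<le> s" for y
    using d(2)[of t y] st r(3) that by auto
  have "J (t, s) < J (t, 0)"
  proof (rule DERIV_neg_imp_decreasing[OF st(1)])
    fix y assume "0 \<le> y" "y \<le> s"
    with J_deriv near(2) show "\<exists>D. ((\<lambda>s. J (t, s)) has_real_derivative D) (at y) \<and> D < 0"
      by blast
  qed
  also have "\<dots> \<le> J (1, 0)"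
    using st(3) r(2) by (intro J_ray) simp
  finally show thesis
    using near(1)[of s] st(1,5) by (intro that[of "(t, s)"]) simp_all
qed

locale nehari = superquadratic F DF p
  for F :: "'a::euclidean_space \<Rightarrow> real" and DF :: "'a \<Rightarrow> 'a" and p :: real +
  fixes M :: "'m measure" and B :: "'a \<times> 'b::euclidean_space \<Rightarrow> 'a \<times> 'b \<Rightarrow> real"
  assumes bounded_bilinear: "bounded_bilinear B"
    and symmetric: "B y z = B z y"
    and positive_definite: "z \<noteq> 0 \<Longrightarrow> 0 < B z z"
begin

interpretation B: bounded_bilinear B
  by (rule bounded_bilinear)

definition finite_energy :: "('m \<Rightarrow> 'a \<times> 'b) \<Rightarrow> bool" where
  "finite_energy Z \<longleftrightarrow> square_integrable M Z \<and> ess_bounded M (\<lambda>x. fst (Z x))"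

definition form :: "('m \<Rightarrow> 'a \<times> 'b) \<Rightarrow> ('m \<Rightarrow> 'a \<times> 'b) \<Rightarrow> real" where
  "form Z Y = (LINT x|M. B (Z x) (Y x))"

definition energy :: "('m \<Rightarrow> 'a \<times> 'b) \<Rightarrow> real" where
  "energy Z = form Z Z / 2 - (LINT x|M. F (fst (Z x)))"

definition constraint :: "('m \<Rightarrow> 'a \<times> 'b) \<Rightarrow> real" where
  "constraint Z = form Z Z - (LINT x|M. G (fst (Z x)))"

definition energy_deriv :: "('m \<Rightarrow> 'a \<times> 'b) \<Rightarrow> ('m \<Rightarrow> 'a \<times> 'b) \<Rightarrow> real" where
  "energy_deriv Z Y = form Z Y - (LINT x|M. DF (fst (Z x)) \<bullet> fst (Y x))"

lemma finite_energyD: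
  assumes "finite_energy Z"
  shows "square_integrable M Z" "square_integrable M (\<lambda>x. fst (Z x))" "ess_bounded M (\<lambda>x. fst (Z x))"
proof -
  show Z: "square_integrable M Z" and "ess_bounded M (\<lambda>x. fst (Z x))"
    using assms by (auto simp: finite_energy_def)
  have measurable: "(\<lambda>x. fst (Z x)) \<in> borel_measurable M"
    by (rule measurable_compose[OF square_integrable_measurable[OF Z] borel_measurable_continuous_onI])
      (intro continuous_intros)
  have "integrable M (\<lambda>x. (norm (fst (Z x)))\<^sup>2)"
  proof (rule Bochner_Integration.integrable_bound[OF integrable_norm_square[OF Z]])
    show "AE x in M. norm ((norm (fst (Z x)))\<^sup>2) \<le> norm ((norm (Z x))\<^sup>2)"
      using norm_fst_le[of "fst (Z x)" "snd (Z x)" for x] by (simp add: power_mono)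
  qed (use measurable in measurable)
  with measurable show "square_integrable M (\<lambda>x. fst (Z x))"
    by (auto simp: square_integrable_def)
qed

lemma finite_energy_lincomb:
  assumes "finite_energy Z" "finite_energy Y"
  shows "finite_energy (\<lambda>x. \<alpha> *\<^sub>R Z x + \<beta> *\<^sub>R Y x)"
  using square_integrable_lincomb[OF finite_energyD(1)[OF assms(1)] finite_energyD(1)[OF assms(2)]]
    ess_bounded_lincomb[OF finite_energyD(3)[OF assms(1)] finite_energyD(3)[OF assms(2)]]
  unfolding finite_energy_def fst_add fst_scaleR by blast

lemma finite_energy_scaleR: "finite_energy Z \<Longrightarrow> finite_energy (\<lambda>x. t *\<^sub>R Z x)"
  using finite_energy_lincomb[of Z Z t 0] by simp

lemma
  assumes f: "continuous_on UNIV f"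
    and bound: "\<And>R. 0 \<le> R \<Longrightarrow> \<exists>C\<ge>0. \<forall>w. norm w \<le> R \<longrightarrow> \<bar>f w\<bar> \<le> C * (norm w)\<^sup>2"
    and Z: "finite_energy Z"
  shows integrable_quadratic_growth: "integrable M (\<lambda>x. f (fst (Z x)))"
    and continuous_on_quadratic_growth: "finite_energy Y \<Longrightarrow>
      continuous_on UNIV (\<lambda>q. LINT x|M. f (fst (fst q *\<^sub>R Z x + snd q *\<^sub>R Y x)))"
proof -
  have continuous: "continuous_on UNIV (\<lambda>q :: 'a \<times> 'a. f (fst q))"
    by (intro continuous_on_compose2[OF f] continuous_intros) auto
  have growth: "\<exists>C\<ge>0. \<forall>w h :: 'a. norm w \<le> R \<longrightarrow> \<bar>f w\<bar> \<le> C * (norm (w, h))\<^sup>2" if R: "0 \<le> R" for R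
  proof -
    obtain C where C: "0 \<le> C" "\<And>w. norm w \<le> R \<Longrightarrow> \<bar>f w\<bar> \<le> C * (norm w)\<^sup>2"
      using bound[OF R] by blast
    have "\<bar>f w\<bar> \<le> C * (norm (w, h))\<^sup>2" if "norm w \<le> R" for w h :: 'a
    proof -
      have "C * (norm w)\<^sup>2 \<le> C * (norm (w, h))\<^sup>2"
        using C(1) by (intro mult_left_mono power_mono norm_fst_le) auto
      with C(2)[OF that] show ?thesis
        by linarith
    qed
    with C(1) show ?thesis
      by blast
  qed
  note Z = finite_energyD(2,3)[OF Z]
  show "integrable M (\<lambda>x. f (fst (Z x)))"
    using integrable_superposition[OF Z Z continuous growth, of 1 0] by simp
  show "continuous_on UNIV (\<lambda>q. LINT x|M. f (fst (fst q *\<^sub>R Z x + snd q *\<^sub>R Y x)))" if "finite_energy Y"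
    using continuous_on_integral_superposition[OF Z finite_energyD(2,3)[OF that] continuous growth]
    by simp
qed

lemma G_continuous: "continuous_on UNIV G"
  unfolding G_def[abs_def] by (intro continuous_intros DF_continuous)

lemma integrable_F: "finite_energy Z \<Longrightarrow> integrable M (\<lambda>x. F (fst (Z x)))"
  by (rule integrable_quadratic_growth[OF F_continuous]) (rule F_bound)

lemma integrable_G: "finite_energy Z \<Longrightarrow> integrable M (\<lambda>x. G (fst (Z x)))"
  by (rule integrable_quadratic_growth[OF G_continuous]) (rule G_bound)

lemma
  assumes Z: "finite_energy Z" and Y: "finite_energy Y"
  shows integrable_DF: "integrable M (\<lambda>x. DF (fst (Z x)) \<bullet> fst (Y x))"
    and continuous_on_integral_DF:
      "continuous_on UNIV (\<lambda>q. LINT x|M. DF (fst (fst q *\<^sub>R Z x + snd q *\<^sub>R Y x)) \<bullet> fst (Y x))"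
proof -
  have continuous: "continuous_on UNIV (\<lambda>q :: 'a \<times> 'a. DF (fst q) \<bullet> snd q)"
    by (intro continuous_intros continuous_on_compose2[OF DF_continuous]) auto
  have growth: "\<exists>C\<ge>0. \<forall>w h. norm w \<le> R \<longrightarrow> \<bar>DF w \<bullet> h\<bar> \<le> C * (norm (w, h))\<^sup>2" if R: "0 \<le> R" for R
  proof -
    obtain C where C: "0 \<le> C" "\<And>w. norm w \<le> R \<Longrightarrow> norm (DF w) \<le> C * norm w"
      using DF_bound[OF R] by blast
    have "\<bar>DF w \<bullet> h\<bar> \<le> C * (norm (w, h))\<^sup>2" if "norm w \<le> R" for w h
    proof -
      have "\<bar>DF w \<bullet> h\<bar> \<le> norm (DF w) * norm h"
        by (rule Cauchy_Schwarz_ineq2)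
      also have "\<dots> \<le> (C * norm (w, h)) * norm (w, h)"
        using C(2)[OF that] mult_left_mono[OF norm_fst_le C(1), of w h]
        by (intro mult_mono norm_snd_le) (auto simp: C(1))
      finally show ?thesis
        by (simp add: power2_eq_square mult.assoc)
    qed
    with C(1) show ?thesis
      by blast
  qed
  note Z = finite_energyD(2,3)[OF Z] and Y = finite_energyD(2,3)[OF Y]
  show "integrable M (\<lambda>x. DF (fst (Z x)) \<bullet> fst (Y x))"
    using integrable_superposition[OF Z Y continuous growth, of 1 0] by simp
  show "continuous_on UNIV (\<lambda>q. LINT x|M. DF (fst (fst q *\<^sub>R Z x + snd q *\<^sub>R Y x)) \<bullet> fst (Y x))"
    using continuous_on_integral_superposition[OF Z Y continuous growth] by simp
qed

lemma integrable_form: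
  assumes "finite_energy Z" "finite_energy Y"
  shows "integrable M (\<lambda>x. B (Z x) (Y x))"
  by (rule integrable_bilinear[OF bounded_bilinear finite_energyD(1)[OF assms(1)]
      finite_energyD(1)[OF assms(2)]])

lemma form_commute: "form Z Y = form Y Z"
  unfolding form_def by (simp add: symmetric)

lemma form_lincomb:
  assumes "finite_energy Z" "finite_energy Y" "finite_energy X"
  shows "form (\<lambda>x. \<alpha> *\<^sub>R Z x + \<beta> *\<^sub>R Y x) X = \<alpha> * form Z X + \<beta> * form Y X"
  using assms by (simp add: form_def B.add_left B.scaleR_left integrable_form)

lemma form_lincomb_self:
  assumes Z: "finite_energy Z" and Y: "finite_energy Y"
  shows "form (\<lambda>x. \<alpha> *\<^sub>R Z x + \<beta> *\<^sub>R Y x) (\<lambda>x. \<alpha> *\<^sub>R Z x + \<beta> *\<^sub>R Y x)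
    = \<alpha>\<^sup>2 * form Z Z + 2 * \<alpha> * \<beta> * form Z Y + \<beta>\<^sup>2 * form Y Y"
proof -
  let ?U = "\<lambda>x. \<alpha> *\<^sub>R Z x + \<beta> *\<^sub>R Y x"
  have "form ?U ?U = \<alpha> * form Z ?U + \<beta> * form Y ?U"
    by (rule form_lincomb[OF Z Y finite_energy_lincomb[OF Z Y]])
  also have "\<dots> = \<alpha> * form ?U Z + \<beta> * form ?U Y"
    by (simp only: form_commute[of Z ?U] form_commute[of Y ?U])
  also have "\<dots> = \<alpha> * (\<alpha> * form Z Z + \<beta> * form Y Z) + \<beta> * (\<alpha> * form Z Y + \<beta> * form Y Y)"
    by (simp only: form_lincomb[OF Z Y Z] form_lincomb[OF Z Y Y])
  finally show ?thesis
    by (simp add: form_commute[of Y Z] power2_eq_square algebra_simps)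
qed

lemma form_scaleR: "form (\<lambda>x. t *\<^sub>R Z x) (\<lambda>x. t *\<^sub>R Z x) = t\<^sup>2 * form Z Z"
  by (simp add: form_def B.scaleR_left B.scaleR_right power2_eq_square mult.assoc)

lemma form_nonneg: "0 \<le> form Z Z"
proof -
  have "0 \<le> B z z" for z
    using positive_definite[of z] by (cases "z = 0") (auto simp: B.zero_left)
  then show ?thesis
    unfolding form_def by (intro integral_nonneg_AE) simp
qed

lemma form_eq_0_iff:
  assumes "finite_energy Z"
  shows "form Z Z = 0 \<longleftrightarrow> (AE x in M. Z x = 0)"
proof -
  have "0 \<le> B z z" "B z z = 0 \<longleftrightarrow> z = 0" for z
    using positive_definite[of z] by (cases "z = 0"; auto simp: B.zero_left)+
  then show ?thesis
    unfolding form_def using integral_nonneg_eq_0_iff_AE[OF integrable_form[OF assms assms]] by simp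
qed

definition remainder_density :: "'a \<times> 'b \<Rightarrow> 'a \<times> 'b \<Rightarrow> real" where
  "remainder_density z y = B y y / 2 - (F (fst z + fst y) - F (fst z) - DF (fst z) \<bullet> fst y)"

lemma
  assumes Z: "finite_energy Z" and Y: "finite_energy Y"
  shows integrable_remainder_density: "integrable M (\<lambda>x. remainder_density (Z x) (Y x))"
    and energy_expansion: "energy (\<lambda>x. Z x + Y x)
      = energy Z + energy_deriv Z Y + (LINT x|M. remainder_density (Z x) (Y x))"
proof -
  have "finite_energy (\<lambda>x. Z x + Y x)"
    using finite_energy_lincomb[OF Z Y, of 1 1] by simp
  note integrable = integrable_form[OF Y Y] integrable_F[OF this, simplified]
    integrable_F[OF Z] integrable_DF[OF Z Y]
  then show "integrable M (\<lambda>x. remainder_density (Z x) (Y x))"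
    by (simp add: remainder_density_def)
  have "(LINT x|M. remainder_density (Z x) (Y x)) = form Y Y / 2 - ((LINT x|M. F (fst (Z x) + fst (Y x)))
      - (LINT x|M. F (fst (Z x))) - (LINT x|M. DF (fst (Z x)) \<bullet> fst (Y x)))"
    using integrable by (simp add: remainder_density_def form_def)
  moreover have "form (\<lambda>x. Z x + Y x) (\<lambda>x. Z x + Y x) = form Z Z + 2 * form Z Y + form Y Y"
    using form_lincomb_self[OF Z Y, of 1 1] by simp
  ultimately show "energy (\<lambda>x. Z x + Y x)
      = energy Z + energy_deriv Z Y + (LINT x|M. remainder_density (Z x) (Y x))"
    by (simp add: energy_def energy_deriv_def add_divide_distrib)
qed

lemma remainder_density_bound:
  assumes "0 \<le> R"
  shows "\<exists>C\<ge>0. \<forall>z y. norm (fst z) \<le> R \<longrightarrow> norm (fst y) \<le> R \<longrightarrow> \<bar>remainder_density z y\<bar> \<le> C * (norm y)\<^sup>2"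
proof -
  obtain C where C: "0 \<le> C"
    "\<And>w h. norm w \<le> R \<Longrightarrow> norm h \<le> R \<Longrightarrow> \<bar>F (w + h) - F w - DF w \<bullet> h\<bar> \<le> C * (norm h)\<^sup>2"
    using F_remainder[OF assms] by blast
  obtain K where K: "0 \<le> K" "\<And>z y. norm (B z y) \<le> norm z * norm y * K"
    using B.nonneg_bounded by blast
  have "\<bar>remainder_density z y\<bar> \<le> (K + C) * (norm y)\<^sup>2" if "norm (fst z) \<le> R" "norm (fst y) \<le> R" for z y
  proof -
    have "C * (norm (fst y))\<^sup>2 \<le> C * (norm y)\<^sup>2"
      using C(1) norm_fst_le[of "fst y" "snd y"] by (intro mult_left_mono power_mono) auto
    with C(2)[OF that] K(2)[of y y] show ?thesis
      by (simp add: remainder_density_def power2_eq_square algebra_simps)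
  qed
  with C(1) K(1) show ?thesis
    by (intro exI[of _ "K + C"]) auto
qed

lemma energy_remainder:
  assumes Z: "finite_energy Z"
  shows "\<exists>C\<ge>0. \<forall>Y. finite_energy Y \<longrightarrow> (AE x in M. norm (fst (Y x)) \<le> S) \<longrightarrow>
    \<bar>energy (\<lambda>x. Z x + Y x) - energy Z - energy_deriv Z Y\<bar> \<le> C * (LINT x|M. (norm (Y x))\<^sup>2)"
proof -
  obtain R where R: "0 \<le> R" "AE x in M. norm (fst (Z x)) \<le> R"
    by (rule ess_boundedE[OF finite_energyD(3)[OF Z]])
  obtain C where C: "0 \<le> C" "\<And>z y. norm (fst z) \<le> max R S \<Longrightarrow> norm (fst y) \<le> max R S
      \<Longrightarrow> \<bar>remainder_density z y\<bar> \<le> C * (norm y)\<^sup>2"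
    using remainder_density_bound[OF max.coboundedI1[OF R(1)], of S] by blast
  have "\<bar>energy (\<lambda>x. Z x + Y x) - energy Z - energy_deriv Z Y\<bar> \<le> C * (LINT x|M. (norm (Y x))\<^sup>2)"
    if Y: "finite_energy Y" and S: "AE x in M. norm (fst (Y x)) \<le> S" for Y
  proof -
    have "\<bar>LINT x|M. remainder_density (Z x) (Y x)\<bar> \<le> (LINT x|M. \<bar>remainder_density (Z x) (Y x)\<bar>)"
      by (rule integral_abs_bound)
    also have "\<dots> \<le> (LINT x|M. C * (norm (Y x))\<^sup>2)"
    proof (rule integral_mono_AE)
      show "AE x in M. \<bar>remainder_density (Z x) (Y x)\<bar> \<le> C * (norm (Y x))\<^sup>2"
        using R(2) S by eventually_elim (intro C(2) max.coboundedI1 max.coboundedI2)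
    qed (use integrable_remainder_density[OF Z Y] integrable_norm_square[OF finite_energyD(1)[OF Y]]
      in auto)
    finally show ?thesis
      by (simp add: energy_expansion[OF Z Y])
  qed
  with C(1) show ?thesis
    by blast
qed

lemma energy_has_derivative:
  assumes Z: "finite_energy Z" and Y: "finite_energy Y"
  shows "((\<lambda>\<beta>. energy (\<lambda>x. \<alpha> *\<^sub>R Z x + \<beta> *\<^sub>R Y x)) has_real_derivative
    energy_deriv (\<lambda>x. \<alpha> *\<^sub>R Z x + \<beta> *\<^sub>R Y x) Y) (at \<beta>)"
proof -
  let ?U = "\<lambda>x. \<alpha> *\<^sub>R Z x + \<beta> *\<^sub>R Y x"
  obtain S where S: "0 \<le> S" "AE x in M. norm (fst (Y x)) \<le> S"
    by (rule ess_boundedE[OF finite_energyD(3)[OF Y]])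
  obtain C where C: "\<And>Y. finite_energy Y \<Longrightarrow> AE x in M. norm (fst (Y x)) \<le> S \<Longrightarrow>
      \<bar>energy (\<lambda>x. ?U x + Y x) - energy ?U - energy_deriv ?U Y\<bar> \<le> C * (LINT x|M. (norm (Y x))\<^sup>2)"
    using energy_remainder[OF finite_energy_lincomb[OF Z Y]] by blast
  show ?thesis
  proof (rule has_real_derivative_if_quadratic_remainder[OF zero_less_one])
    fix s :: real assume s: "\<bar>s\<bar> < 1"
    have "AE x in M. norm (fst (s *\<^sub>R Y x)) \<le> S"
      using S(2)
    proof eventually_elim
      case (elim x)
      have "\<bar>s\<bar> * norm (fst (Y x)) \<le> 1 * norm (fst (Y x))"
        using s by (intro mult_right_mono) auto
      with elim show ?case
        by simp
    qed
    then have "\<bar>energy (\<lambda>x. ?U x + s *\<^sub>R Y x) - energy ?U - energy_deriv ?U (\<lambda>x. s *\<^sub>R Y x)\<bar>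
        \<le> C * (LINT x|M. (norm (s *\<^sub>R Y x))\<^sup>2)"
      by (rule C[OF finite_energy_scaleR[OF Y]])
    moreover have "energy_deriv ?U (\<lambda>x. s *\<^sub>R Y x) = s * energy_deriv ?U Y"
      by (simp add: energy_deriv_def form_def B.scaleR_right right_diff_distrib)
    ultimately show "\<bar>energy (\<lambda>x. \<alpha> *\<^sub>R Z x + (\<beta> + s) *\<^sub>R Y x) - energy ?U - s * energy_deriv ?U Y\<bar>
        \<le> C * (LINT x|M. (norm (Y x))\<^sup>2) * s\<^sup>2"
      by (simp add: scaleR_add_left add.assoc power_mult_distrib mult_ac)
  qed
qed

lemma
  assumes Z: "finite_energy Z" and Y: "finite_energy Y" and eq: "AE x in M. Z x = Y x"
  shows energy_cong_AE: "energy Z = energy Y" and constraint_cong_AE: "constraint Z = constraint Y"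
proof -
  have form: "form Z Z = form Y Y"
    unfolding form_def using eq integrable_form[OF Z Z] integrable_form[OF Y Y]
    by (intro integral_cong_AE) (auto elim!: eventually_mono)
  have "(LINT x|M. F (fst (Z x))) = (LINT x|M. F (fst (Y x)))"
    using eq integrable_F[OF Z] integrable_F[OF Y]
    by (intro integral_cong_AE) (auto elim!: eventually_mono)
  with form show "energy Z = energy Y"
    by (simp add: energy_def)
  have "(LINT x|M. G (fst (Z x))) = (LINT x|M. G (fst (Y x)))"
    using eq integrable_G[OF Z] integrable_G[OF Y]
    by (intro integral_cong_AE) (auto elim!: eventually_mono)
  with form show "constraint Z = constraint Y"
    by (simp add: constraint_def)
qed

lemma continuous_on_form_plane:
  assumes "finite_energy Z" "finite_energy Y"
  shows "continuous_on UNIV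
    (\<lambda>q. form (\<lambda>x. fst q *\<^sub>R Z x + snd q *\<^sub>R Y x) (\<lambda>x. fst q *\<^sub>R Z x + snd q *\<^sub>R Y x))"
  unfolding form_lincomb_self[OF assms] by (intro continuous_intros)

lemma continuous_on_constraint_plane:
  assumes "finite_energy Z" "finite_energy Y"
  shows "continuous_on UNIV (\<lambda>q. constraint (\<lambda>x. fst q *\<^sub>R Z x + snd q *\<^sub>R Y x))"
  unfolding constraint_def
  using continuous_on_form_plane[OF assms] continuous_on_quadratic_growth[OF G_continuous G_bound assms]
  by (rule continuous_on_diff)

lemma continuous_on_energy_deriv_plane:
  assumes "finite_energy Z" "finite_energy Y"
  shows "continuous_on UNIV (\<lambda>q. energy_deriv (\<lambda>x. fst q *\<^sub>R Z x + snd q *\<^sub>R Y x) Y)"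
  unfolding energy_deriv_def form_lincomb[OF assms assms(2)]
  by (intro continuous_on_diff continuous_on_integral_DF[OF assms] continuous_intros)

context
  fixes Z
  assumes Z: "finite_energy Z" and constraint: "constraint Z = 0"
begin

lemma integral_G_eq_form: "(LINT x|M. G (fst (Z x))) = form Z Z"
  using constraint by (simp add: constraint_def)

lemma energy_nonneg: "0 \<le> energy Z"
proof -
  have "(LINT x|M. F (fst (Z x))) \<le> (LINT x|M. G (fst (Z x)) / (p + 2))"
    using integrable_F[OF Z] integrable_G[OF Z] F_le_G by (intro integral_mono) auto
  also have "\<dots> = form Z Z / (p + 2)"
    by (simp add: integral_G_eq_form)
  also have "\<dots> \<le> form Z Z / 2"
    using form_nonneg p_pos by (intro divide_left_mono) auto
  finally show ?thesis
    by (simp add: energy_def)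
qed

lemma constraint_ray_pos:
  assumes "0 < form Z Z" "0 < t" "t < 1"
  shows "0 < constraint (\<lambda>x. t *\<^sub>R Z x)"
proof -
  have "(LINT x|M. G (fst (t *\<^sub>R Z x))) \<le> (LINT x|M. t powr (p + 2) * G (fst (Z x)))"
    using integrable_G[OF Z] integrable_G[OF finite_energy_scaleR[OF Z], of t] G_scale_le[of t]
      assms(2,3)
    by (intro integral_mono) auto
  also have "\<dots> = t powr (p + 2) * form Z Z"
    by (simp add: integral_G_eq_form)
  also have "\<dots> < t powr 2 * form Z Z"
    using assms p_pos by (intro mult_strict_right_mono powr_less_mono') auto
  finally show ?thesis
    using assms(2) by (simp add: constraint_def form_scaleR)
qed

lemma constraint_ray_neg:
  assumes "0 < form Z Z" "1 < t"
  shows "constraint (\<lambda>x. t *\<^sub>R Z x) < 0"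
proof -
  have "t powr 2 * form Z Z < t powr (p + 2) * form Z Z"
    using assms p_pos by (intro mult_strict_right_mono powr_less_mono) auto
  also have "\<dots> = (LINT x|M. t powr (p + 2) * G (fst (Z x)))"
    by (simp add: integral_G_eq_form)
  also have "\<dots> \<le> (LINT x|M. G (fst (t *\<^sub>R Z x)))"
    using integrable_G[OF Z] integrable_G[OF finite_energy_scaleR[OF Z], of t] G_scale_ge[of t] assms(2)
    by (intro integral_mono) auto
  finally show ?thesis
    using assms(2) by (simp add: constraint_def form_scaleR)
qed

lemma energy_ray_le:
  assumes "0 < t"
  shows "energy (\<lambda>x. t *\<^sub>R Z x) \<le> energy Z"
proof -
  let ?k = "(t powr (p + 2) - 1) / (p + 2)"
  note integrable = integrable_F[OF Z] integrable_G[OF Z]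
    integrable_F[OF finite_energy_scaleR[OF Z], of t]
  have "(p + 2) / 2 * (t\<^sup>2 - 1) \<le> (t\<^sup>2) powr ((p + 2) / 2) - 1"
    using p_pos assms by (intro powr_Bernoulli) auto
  also have "(t\<^sup>2) powr ((p + 2) / 2) = t powr (p + 2)"
    using assms powr_powr[of t 2 "(p + 2) / 2"] by (simp add: add_divide_distrib)
  finally have "form Z Z * ((t\<^sup>2 - 1) / 2) \<le> form Z Z * ?k"
    using p_pos form_nonneg by (intro mult_left_mono) (auto simp: field_simps)
  also have "\<dots> = (LINT x|M. G (fst (Z x)) * ?k)"
    by (simp add: integral_G_eq_form)
  also have "\<dots> \<le> (LINT x|M. F (fst (t *\<^sub>R Z x)) - F (fst (Z x)))"
    using integrable F_scale_ge[of t] assms by (intro integral_mono) auto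
  also have "\<dots> = (LINT x|M. F (fst (t *\<^sub>R Z x))) - (LINT x|M. F (fst (Z x)))"
    using integrable by simp
  finally show ?thesis
    by (simp add: energy_def form_scaleR field_simps)
qed

context
  fixes Y
  assumes Y: "finite_energy Y"
    and minimal: "\<And>\<alpha> \<beta>. constraint (\<lambda>x. \<alpha> *\<^sub>R Z x + \<beta> *\<^sub>R Y x) = 0 \<Longrightarrow>
      \<not> (AE x in M. \<alpha> *\<^sub>R Z x + \<beta> *\<^sub>R Y x = 0) \<Longrightarrow> energy Z \<le> energy (\<lambda>x. \<alpha> *\<^sub>R Z x + \<beta> *\<^sub>R Y x)"
begin

lemma energy_deriv_nonneg_if_minimal: "0 \<le> energy_deriv Z Y"
proof (cases "form Z Z = 0")
  case True
  then have "AE x in M. B (Z x) (Y x) = 0 \<and> DF (fst (Z x)) \<bullet> fst (Y x) = 0"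
    unfolding form_eq_0_iff[OF Z] by eventually_elim (simp add: B.zero_left DF_0)
  then show ?thesis
    by (simp add: energy_deriv_def form_def integral_eq_zero_AE)
next
  case False
  with form_nonneg[of Z] have form_pos: "0 < form Z Z"
    by linarith
  let ?U = "\<lambda>q x. fst q *\<^sub>R Z x + snd q *\<^sub>R Y x"
  show ?thesis
  proof (rule ccontr)
    assume "\<not> 0 \<le> energy_deriv Z Y"
    obtain q where "0 < form (?U q) (?U q)" "constraint (?U q) = 0" "energy (?U q) < energy Z"
    proof (rule constrained_descent_in_plane)
      show "continuous_on UNIV (\<lambda>q. constraint (?U q))" "continuous_on UNIV (\<lambda>q. energy_deriv (?U q) Y)"
        using Z Y by (fact continuous_on_constraint_plane continuous_on_energy_deriv_plane)+
      show "open {q. 0 < form (?U q) (?U q)}"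
        using continuous_on_form_plane[OF Z Y] by (intro open_Collect_less continuous_on_const)
      show "((\<lambda>s. energy (?U (t, s))) has_real_derivative energy_deriv (?U (t, s)) Y) (at s)" for t s
        using energy_has_derivative[OF Z Y] by simp
    qed (use form_pos constraint_ray_pos constraint_ray_neg energy_ray_le
      \<open>\<not> 0 \<le> energy_deriv Z Y\<close> in auto)
    then show False
      using minimal[of "fst q" "snd q"] form_eq_0_iff[OF finite_energy_lincomb[OF Z Y]] by force
  qed
qed

end

theorem energy_deriv_eq_0_if_minimal:
  assumes Y: "finite_energy Y"
    and minimal: "\<And>\<alpha> \<beta>. constraint (\<lambda>x. \<alpha> *\<^sub>R Z x + \<beta> *\<^sub>R Y x) = 0 \<Longrightarrow>
      \<not> (AE x in M. \<alpha> *\<^sub>R Z x + \<beta> *\<^sub>R Y x = 0) \<Longrightarrow> energy Z \<le> energy (\<lambda>x. \<alpha> *\<^sub>R Z x + \<beta> *\<^sub>R Y x)"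
  shows "energy_deriv Z Y = 0"
proof -
  have "0 \<le> energy_deriv Z (\<lambda>x. - Y x)"
    using finite_energy_scaleR[OF Y, of "-1"] minimal[of _ "- _"]
    by (intro energy_deriv_nonneg_if_minimal) auto
  then have "energy_deriv Z Y \<le> 0"
    by (simp add: energy_deriv_def form_def B.minus_right)
  moreover have "0 \<le> energy_deriv Z Y"
    using Y minimal by (rule energy_deriv_nonneg_if_minimal)
  ultimately show ?thesis
    by simp
qed

end

end

section \<open>The Boussinesq functional\<close>

lemma vec4_nth [simp]:
  "vec4 x1 x2 x3 x4 $ 1 = x1" "vec4 x1 x2 x3 x4 $ 2 = x2"
  "vec4 x1 x2 x3 x4 $ 3 = x3" "vec4 x1 x2 x3 x4 $ 4 = x4"
  by (simp_all add: vec4_def vector_def)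

lemma vec4_eq: "vec4 x1 x2 x3 x4 = x1 *\<^sub>R axis 1 1 + x2 *\<^sub>R axis 2 1 + x3 *\<^sub>R axis 3 1 + x4 *\<^sub>R axis 4 1"
  by (simp add: vec_eq_iff forall_4 axis_def)

lemma norm_vec4_sq: "(norm (vec4 x1 x2 x3 x4))\<^sup>2 = x1\<^sup>2 + x2\<^sup>2 + x3\<^sup>2 + x4\<^sup>2"
  by (simp add: norm_vec_def L2_set_def sum_4)

lemma norm_vec4_le: "norm (vec4 x1 x2 x3 x4) \<le> \<bar>x1\<bar> + \<bar>x2\<bar> + \<bar>x3\<bar> + \<bar>x4\<bar>"
  using norm_le_l1_cart[of "vec4 x1 x2 x3 x4"] by (simp add: sum_4)

lemma has_derivative_grad:
  assumes "f differentiable (at w)"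
  shows "(f has_derivative (\<lambda>h. grad f w \<bullet> h)) (at w)"
proof -
  let ?D = "frechet_derivative f (at w)"
  have D: "(f has_derivative ?D) (at w)"
    using assms frechet_derivative_works by blast
  then have linear: "linear ?D"
    by (rule has_derivative_linear)
  have "?D h = grad f w \<bullet> h" for h
  proof -
    have "?D h = ?D (\<Sum>i\<in>UNIV. h $ i *\<^sub>R axis i 1)"
      using basis_expansion[of h] by (simp add: scalar_mult_eq_scaleR)
    also have "\<dots> = (\<Sum>i\<in>UNIV. h $ i *\<^sub>R ?D (axis i 1))"
      using linear by (simp add: linear_sum linear_scale)
    also have "\<dots> = grad f w \<bullet> h"
      by (simp add: grad_def inner_vec_def mult.commute)
    finally show ?thesis .
  qed
  then have "?D = (\<lambda>h. grad f w \<bullet> h)"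
    by blast
  with D show ?thesis
    by simp
qed

context
  fixes F :: "real^4 \<Rightarrow> real"
  assumes F: "C2_R4 F"
begin

lemma grad_has_derivative: "(grad F has_derivative (\<lambda>h. hess F w *v h)) (at w)"
  using F jacobian_works unfolding C2_R4_def hess_def by blast

lemma Gfun_has_derivative: "(Gfun F has_derivative (\<lambda>h. grad (Gfun F) w \<bullet> h)) (at w)"
proof (rule has_derivative_grad)
  have "(Gfun F has_derivative (\<lambda>h. w \<bullet> (hess F w *v h) + h \<bullet> grad F w)) (at w)"
    unfolding Gfun_def[abs_def]
    by (rule has_derivative_inner[OF has_derivative_ident grad_has_derivative])
  then show "Gfun F differentiable (at w)"
    unfolding differentiable_def by blast
qed

lemma grad_lipschitz: "\<exists>L. L-lipschitz_on (cball 0 R) (grad F)"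
proof -
  have "bounded (hess F ` cball 0 R)"
    using F unfolding C2_R4_def
    by (intro compact_imp_bounded compact_continuous_image) (auto intro: continuous_on_subset)
  then obtain H where H: "H > 0" "\<And>x. x \<in> cball 0 R \<Longrightarrow> norm (hess F x) \<le> H"
    unfolding bounded_pos by force
  have "\<bar>hess F x $ i $ j\<bar> \<le> H" if "x \<in> cball 0 R" for x i j
    by (rule order_trans[OF order_trans[OF component_le_norm_cart Finite_Cartesian_Product.norm_nth_le]
        H(2)[OF that]])
  then have "onorm ((*v) (hess F x)) \<le> real CARD(4) * real CARD(4) * H" if "x \<in> cball 0 R" for x
    using that by (intro onorm_le_matrix_component)
  then show ?thesis
    using H(1) grad_has_derivative
    by (intro exI bounded_derivative_imp_lipschitz[where f' = "\<lambda>x. (*v) (hess F x)"])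
      (auto intro: has_derivative_at_withinI)
qed

lemma superquadratic_grad:
  assumes "F 0 = 0" "0 < p" and Euler: "\<And>w. (p + 2) * Gfun F w \<le> w \<bullet> grad (Gfun F) w"
  shows "superquadratic F (grad F) p"
proof
  show "(F has_derivative (\<lambda>h. grad F w \<bullet> h)) (at w)" for w
    using F has_derivative_grad unfolding C2_R4_def by blast
  show "t powr (p + 2) * (w \<bullet> grad F w) \<le> (t *\<^sub>R w) \<bullet> grad F (t *\<^sub>R w)" if "1 \<le> t" for t w
    using superhomogeneous_if_Euler_inequality[OF Gfun_has_derivative _ that] Euler
    unfolding Gfun_def by (simp add: inner_commute)
qed (use assms grad_lipschitz in auto)

end

definition coupled_form :: "real \<Rightarrow> real \<Rightarrow> real \<Rightarrow> real \<times> real \<Rightarrow> real \<times> real \<Rightarrow> real" where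
  "coupled_form A D m u v = A * (fst u * fst v) + D * (snd u * snd v)
      - m * (fst u * snd v + snd u * fst v)"

lemma coupled_form_pos:
  assumes m: "\<bar>m\<bar> < A" "\<bar>m\<bar> < D" and u: "u \<noteq> 0"
  shows "0 < coupled_form A D m u u"
proof -
  obtain x y where xy: "u = (x, y)"
    by (cases u)
  have "2 * \<bar>x * y\<bar> \<le> x\<^sup>2 + y\<^sup>2"
    using sum_squares_bound[of "\<bar>x\<bar>" "\<bar>y\<bar>"] by (simp add: abs_mult)
  then have "\<bar>m\<bar> * (2 * \<bar>x * y\<bar>) \<le> \<bar>m\<bar> * (x\<^sup>2 + y\<^sup>2)"
    by (rule mult_left_mono) simp
  moreover have "m * (2 * (x * y)) \<le> \<bar>m\<bar> * (2 * \<bar>x * y\<bar>)"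
    using abs_ge_self[of "m * (2 * (x * y))"] by (simp add: abs_mult)
  ultimately have "(A - \<bar>m\<bar>) * x\<^sup>2 + (D - \<bar>m\<bar>) * y\<^sup>2 \<le> coupled_form A D m u u"
    by (simp add: coupled_form_def xy power2_eq_square algebra_simps)
  moreover have "0 < (A - \<bar>m\<bar>) * x\<^sup>2 + (D - \<bar>m\<bar>) * y\<^sup>2"
    using m u by (cases "x = 0") (auto simp: xy zero_prod_def intro: add_pos_nonneg)
  ultimately show ?thesis
    by linarith
qed

lemma coupled_form_nonneg:
  assumes "\<bar>m\<bar> < A" "\<bar>m\<bar> < D"
  shows "0 \<le> coupled_form A D m u u"
  using coupled_form_pos[OF assms, of u] by (cases "u = 0") (auto simp: coupled_form_def)

type_synonym jet_space = "(real^4) \<times> real \<times> real"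

definition jet :: "(real \<Rightarrow> real) \<Rightarrow> (real \<Rightarrow> real) \<Rightarrow> real \<Rightarrow> jet_space" where
  "jet \<psi> v x = (vec4 (\<psi> x) (wd \<psi> x) (v x) (wd v x), wd (wd \<psi>) x, wd (wd v) x)"

definition quadratic_density :: "real \<Rightarrow> real \<Rightarrow> real \<Rightarrow> real \<Rightarrow> real \<Rightarrow> real \<Rightarrow> real
    \<Rightarrow> jet_space \<Rightarrow> jet_space \<Rightarrow> real" where
  "quadratic_density a a2 c c2 b b2 \<omega> z y =
     coupled_form 1 1 \<omega> (fst z $ 1, fst z $ 3) (fst y $ 1, fst y $ 3)
     + coupled_form (- c) (- a) (\<omega> * b) (fst z $ 2, fst z $ 4) (fst y $ 2, fst y $ 4)
     + coupled_form c2 a2 (\<omega> * b2) (snd z) (snd y)"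

lemma bounded_bilinear_quadratic_density: "bounded_bilinear (quadratic_density a a2 c c2 b b2 \<omega>)"
  unfolding bilinear_conv_bounded_bilinear[symmetric] bilinear_def
  by (auto intro!: linearI simp: quadratic_density_def coupled_form_def algebra_simps)

lemma quadratic_density_commute:
  "quadratic_density a a2 c c2 b b2 \<omega> y z = quadratic_density a a2 c c2 b b2 \<omega> z y"
  by (simp add: quadratic_density_def coupled_form_def algebra_simps)

lemma quadratic_density_pos:
  assumes "b > 0" "b2 > 0" "\<bar>\<omega>\<bar> < Min {1, -a / b, -c / b, a2 / b2, c2 / b2}" and "z \<noteq> 0"
  shows "0 < quadratic_density a a2 c c2 b b2 \<omega> z z"
proof -
  have \<omega>: "\<bar>\<omega>\<bar> < 1" "\<bar>\<omega> * b\<bar> < - a" "\<bar>\<omega> * b\<bar> < - c" "\<bar>\<omega> * b2\<bar> < a2" "\<bar>\<omega> * b2\<bar> < c2"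
    using assms(1-3) pos_less_divide_eq[of b "\<bar>\<omega>\<bar>" "- a"] pos_less_divide_eq[of b "\<bar>\<omega>\<bar>" "- c"]
    by (auto simp: abs_mult pos_less_divide_eq)
  note nonneg = coupled_form_nonneg[OF \<omega>(1,1), of "(fst z $ 1, fst z $ 3)"]
    coupled_form_nonneg[OF \<omega>(3,2), of "(fst z $ 2, fst z $ 4)"]
    coupled_form_nonneg[OF \<omega>(5,4), of "snd z"]
  consider "(fst z $ 1, fst z $ 3) \<noteq> 0" | "(fst z $ 2, fst z $ 4) \<noteq> 0" | "snd z \<noteq> 0"
    using \<open>z \<noteq> 0\<close> by (auto simp: prod_eq_iff vec_eq_iff forall_4)
  then show ?thesis
  proof cases
    case 1
    with nonneg coupled_form_pos[OF \<omega>(1,1)] show ?thesis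
      unfolding quadratic_density_def by (intro add_pos_nonneg)
  next
    case 2
    with nonneg coupled_form_pos[OF \<omega>(3,2)] show ?thesis
      unfolding quadratic_density_def by (intro add_pos_nonneg add_nonneg_pos)
  next
    case 3
    with nonneg coupled_form_pos[OF \<omega>(5,4)] show ?thesis
      unfolding quadratic_density_def by (intro add_nonneg_pos add_nonneg_nonneg)
  qed
qed

lemma
  assumes "H2 u"
  shows integrable_H2_norm_sq: "integrable lborel (\<lambda>x. (u x)\<^sup>2 + (wd u x)\<^sup>2 + (wd (wd u) x)\<^sup>2)"
    and H2_norm_sq_eq: "H2_norm_sq u = (LINT x|lborel. (u x)\<^sup>2)
        + (LINT x|lborel. (wd u x)\<^sup>2) + (LINT x|lborel. (wd (wd u) x)\<^sup>2)"
  using H2D(1-3)[OF assms] by (simp_all add: sq_int_def H2_norm_sq_def)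

lemma H2_norm_sq_nonneg: "0 \<le> H2_norm_sq u"
  unfolding H2_norm_sq_def by (intro integral_nonneg_AE) simp

lemma X_norm_nonneg: "0 \<le> X_norm \<psi> v"
  by (simp add: X_norm_def H2_norm_sq_nonneg)

lemma H2_ess_bound:
  assumes u: "H2 u" and le: "H2_norm_sq u \<le> N\<^sup>2" "0 \<le> N"
  shows "AE x in lborel. \<bar>u x\<bar> \<le> 5/2 * N" "AE x in lborel. \<bar>wd u x\<bar> \<le> 5/2 * N"
proof -
  have nonneg: "0 \<le> (LINT x|lborel. (f x)\<^sup>2)" for f :: "real \<Rightarrow> real"
    by (intro integral_nonneg_AE) simp
  have "(LINT x|lborel. (u x)\<^sup>2) + (LINT x|lborel. (wd u x)\<^sup>2) \<le> N\<^sup>2"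
    "(LINT x|lborel. (wd u x)\<^sup>2) + (LINT x|lborel. (wd (wd u) x)\<^sup>2) \<le> N\<^sup>2"
    using H2_norm_sq_eq[OF u] le(1) nonneg[of u] nonneg[of "wd (wd u)"] by linarith+
  then have sqrt_le: "sqrt ((LINT x|lborel. (u x)\<^sup>2) + (LINT x|lborel. (wd u x)\<^sup>2)) \<le> N"
    "sqrt ((LINT x|lborel. (wd u x)\<^sup>2) + (LINT x|lborel. (wd (wd u) x)\<^sup>2)) \<le> N"
    using le(2) by (simp_all add: real_le_lsqrt)
  show "AE x in lborel. \<bar>u x\<bar> \<le> 5/2 * N"
    using H1_ess_bound[OF H2D(4,1,2)[OF u]] by eventually_elim (use sqrt_le(1) in linarith)
  show "AE x in lborel. \<bar>wd u x\<bar> \<le> 5/2 * N"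
    using H1_ess_bound[OF H2D(5,2,3)[OF u]] by eventually_elim (use sqrt_le(2) in linarith)
qed

lemma norm_jet_sq:
  "(norm (jet \<psi> v x))\<^sup>2 = ((\<psi> x)\<^sup>2 + (wd \<psi> x)\<^sup>2 + (wd (wd \<psi>) x)\<^sup>2)
      + ((v x)\<^sup>2 + (wd v x)\<^sup>2 + (wd (wd v) x)\<^sup>2)"
  by (simp add: jet_def norm_Pair norm_vec4_sq)

lemma integral_norm_jet_sq:
  assumes "H2 \<psi>" "H2 v"
  shows "(LINT x|lborel. (norm (jet \<psi> v x))\<^sup>2) = (X_norm \<psi> v)\<^sup>2"
  unfolding norm_jet_sq X_norm_def
  using integrable_H2_norm_sq[OF assms(1)] integrable_H2_norm_sq[OF assms(2)] H2_norm_sq_nonneg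
  by (simp add: H2_norm_sq_def[symmetric])

lemma square_integrable_jet:
  assumes "H2 \<psi>" "H2 v"
  shows "square_integrable lborel (jet \<psi> v)"
proof -
  have [measurable]: "\<psi> \<in> borel_measurable borel" "wd \<psi> \<in> borel_measurable borel"
    "wd (wd \<psi>) \<in> borel_measurable borel"
    "v \<in> borel_measurable borel" "wd v \<in> borel_measurable borel" "wd (wd v) \<in> borel_measurable borel"
    using H2D(1-3)[OF assms(1)] H2D(1-3)[OF assms(2)] by (auto simp: sq_int_def)
  have "jet \<psi> v \<in> borel_measurable lborel"
    unfolding jet_def[abs_def] vec4_eq by measurable
  then show ?thesis
    using assms by (simp add: square_integrable_def norm_jet_sq integrable_H2_norm_sq)
qed

lemma jet_ess_bound:
  assumes "H2 \<psi>" "H2 v"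
  shows "AE x in lborel. norm (fst (jet \<psi> v x)) \<le> 10 * X_norm \<psi> v"
proof -
  have "H2_norm_sq \<psi> \<le> (X_norm \<psi> v)\<^sup>2" "H2_norm_sq v \<le> (X_norm \<psi> v)\<^sup>2"
    by (simp_all add: X_norm_def H2_norm_sq_nonneg)
  note bounds = H2_ess_bound[OF assms(1) this(1) X_norm_nonneg]
    H2_ess_bound[OF assms(2) this(2) X_norm_nonneg]
  from bounds show ?thesis
  proof eventually_elim
    case (elim x)
    then show ?case
      using norm_vec4_le[of "\<psi> x" "wd \<psi> x" "v x" "wd v x"] by (simp add: jet_def)
  qed
qed

lemma jet_lincomb:
  assumes "H2 \<psi>" "H2 v" "H2 h" "H2 k"
  shows "AE x in lborel. jet (\<lambda>x. \<alpha> * \<psi> x + \<beta> * h x) (\<lambda>x. \<alpha> * v x + \<beta> * k x) x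
    = \<alpha> *\<^sub>R jet \<psi> v x + \<beta> *\<^sub>R jet h k x"
  using H2_lincomb(2,3)[OF assms(1,3), of \<alpha> \<beta>] H2_lincomb(2,3)[OF assms(2,4), of \<alpha> \<beta>]
proof eventually_elim
  case (elim x)
  show ?case
    by (simp add: jet_def vec4_eq elim[symmetric] algebra_simps)
qed

lemma jet_AE_eq_0:
  assumes "H2 \<psi>" "H2 v" "X_zero \<psi> v"
  shows "AE x in lborel. jet \<psi> v x = 0"
proof -
  have zero: "weak_deriv (\<lambda>_. 0) (\<lambda>_. 0)"
    by (simp add: weak_deriv_def loc_integrable_const)
  have wd_zero: "AE x in lborel. 0 = wd u x \<and> 0 = wd (wd u) x"
      if u: "H2 u" "AE x in lborel. u x = 0" for u
  proof -
    have "AE x in lborel. 0 = u x"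
      using u(2) by eventually_elim simp
    then have "weak_deriv u (\<lambda>_. 0)"
      using H2D(1)[OF u(1)] by (intro weak_deriv_cong_AE[OF zero]) (auto simp: sq_int_def)
    from wd_AE_eq(2)[OF this] wd_wd_AE_eq(2)[OF this zero] show ?thesis
      by eventually_elim simp
  qed
  have "AE x in lborel. \<psi> x = 0" "AE x in lborel. v x = 0"
    using assms(3) by (auto simp: X_zero_def)
  with wd_zero[OF assms(1)] wd_zero[OF assms(2)] show ?thesis
    by (auto simp: jet_def vec4_eq zero_prod_def elim!: eventually_elim2)
qed

lemma Iw_eq_integral_quadratic_density:
  assumes "H2 \<psi>" "H2 v"
  shows "Iw a a2 c c2 b b2 \<omega> \<psi> v
    = (LINT x|lborel. quadratic_density a a2 c c2 b b2 \<omega> (jet \<psi> v x) (jet \<psi> v x))"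
proof -
  note \<psi> = H2D(1-3)[OF assms(1)] and v = H2D(1-3)[OF assms(2)]
  have "integrable lborel (\<lambda>x. f x * g x)" if "sq_int f" "sq_int g" for f g
    using that unfolding sq_int_iff by (rule integrable_bilinear[OF bounded_bilinear_mult])
  note mixed = this[OF \<psi>(1) v(1)] this[OF \<psi>(2) v(2)] this[OF \<psi>(3) v(3)]
  have I1: "integrable lborel (\<lambda>x. (\<psi> x)\<^sup>2 - c * (wd \<psi> x)\<^sup>2 + c2 * (wd (wd \<psi>) x)\<^sup>2
      + (v x)\<^sup>2 - a * (wd v x)\<^sup>2 + a2 * (wd (wd v) x)\<^sup>2)"
    using \<psi> v by (simp add: sq_int_def)
  have I2: "integrable lborel (\<lambda>x. \<psi> x * v x + b * wd \<psi> x * wd v x + b2 * wd (wd \<psi>) x * wd (wd v) x)"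
    using mixed by (simp add: mult.assoc)
  have "Iw a a2 c c2 b b2 \<omega> \<psi> v = (LINT x|lborel. ((\<psi> x)\<^sup>2 - c * (wd \<psi> x)\<^sup>2 + c2 * (wd (wd \<psi>) x)\<^sup>2
      + (v x)\<^sup>2 - a * (wd v x)\<^sup>2 + a2 * (wd (wd v) x)\<^sup>2)
      - 2 * \<omega> * (\<psi> x * v x + b * wd \<psi> x * wd v x + b2 * wd (wd \<psi>) x * wd (wd v) x))"
    unfolding Iw_def I1_def I2_def using I1 I2 by simp
  also have "\<dots> = (LINT x|lborel. quadratic_density a a2 c c2 b b2 \<omega> (jet \<psi> v x) (jet \<psi> v x))"
    by (intro Bochner_Integration.integral_cong)
      (simp_all add: quadratic_density_def coupled_form_def jet_def power2_eq_square algebra_simps)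
  finally show ?thesis .
qed

locale boussinesq =
  fixes a a2 c c2 b b2 \<omega> :: real and F :: "real^4 \<Rightarrow> real" and p :: real
  assumes b_pos: "b > 0" "b2 > 0"
    and frequency_bound: "\<bar>\<omega>\<bar> < Min {1, -a / b, -c / b, a2 / b2, c2 / b2}"
    and F_C2: "C2_R4 F" and F_at_0: "F 0 = 0"
    and exponent_pos: "p > 0" and Euler_inequality: "(p + 2) * Gfun F w \<le> w \<bullet> grad (Gfun F) w"
begin

sublocale nehari F "grad F" p lborel "quadratic_density a a2 c c2 b b2 \<omega>"
  using superquadratic_grad[OF F_C2 F_at_0 exponent_pos Euler_inequality]
    bounded_bilinear_quadratic_density
    quadratic_density_commute quadratic_density_pos[OF b_pos frequency_bound]
  by (simp add: nehari_def nehari_axioms_def)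

abbreviation J :: "(real \<Rightarrow> real) \<Rightarrow> (real \<Rightarrow> real) \<Rightarrow> real" where
  "J \<equiv> Jw a a2 c c2 b b2 \<omega> F"

abbreviation P :: "(real \<Rightarrow> real) \<Rightarrow> (real \<Rightarrow> real) \<Rightarrow> real" where
  "P \<equiv> Pw a a2 c c2 b b2 \<omega> F"

lemma finite_energy_jet: "H2 \<psi> \<Longrightarrow> H2 v \<Longrightarrow> finite_energy (jet \<psi> v)"
  unfolding finite_energy_def ess_bounded_def using square_integrable_jet jet_ess_bound by blast

lemma
  assumes "H2 \<psi>" "H2 v"
  shows J_eq_energy: "J \<psi> v = energy (jet \<psi> v)" and P_eq_constraint: "P \<psi> v = constraint (jet \<psi> v)"
  by (simp_all add: Jw_def Pw_def energy_def constraint_def form_def G_def Gfun_def Kfun_def Nfun_def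
      Iw_eq_integral_quadratic_density[OF assms] jet_def)

lemma
  assumes "H2 \<psi>" "H2 v" "H2 h" "H2 k"
  shows J_lincomb: "J (\<lambda>x. \<alpha> * \<psi> x + \<beta> * h x) (\<lambda>x. \<alpha> * v x + \<beta> * k x)
      = energy (\<lambda>x. \<alpha> *\<^sub>R jet \<psi> v x + \<beta> *\<^sub>R jet h k x)"
    and P_lincomb: "P (\<lambda>x. \<alpha> * \<psi> x + \<beta> * h x) (\<lambda>x. \<alpha> * v x + \<beta> * k x)
      = constraint (\<lambda>x. \<alpha> *\<^sub>R jet \<psi> v x + \<beta> *\<^sub>R jet h k x)"
proof -
  note H2 = H2_lincomb(1)[OF assms(1,3), of \<alpha> \<beta>] H2_lincomb(1)[OF assms(2,4), of \<alpha> \<beta>]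
  note cong = finite_energy_jet[OF H2] finite_energy_lincomb[OF finite_energy_jet[OF assms(1,2)]
      finite_energy_jet[OF assms(3,4)]] jet_lincomb[OF assms]
  show "J (\<lambda>x. \<alpha> * \<psi> x + \<beta> * h x) (\<lambda>x. \<alpha> * v x + \<beta> * k x)
      = energy (\<lambda>x. \<alpha> *\<^sub>R jet \<psi> v x + \<beta> *\<^sub>R jet h k x)"
    unfolding J_eq_energy[OF H2] using cong by (rule energy_cong_AE)
  show "P (\<lambda>x. \<alpha> * \<psi> x + \<beta> * h x) (\<lambda>x. \<alpha> * v x + \<beta> * k x)
      = constraint (\<lambda>x. \<alpha> *\<^sub>R jet \<psi> v x + \<beta> *\<^sub>R jet h k x)"
    unfolding P_eq_constraint[OF H2] using cong by (rule constraint_cong_AE)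
qed

lemma Sw_le:
  assumes "H2 \<psi>" "H2 v" "P \<psi> v = 0" "\<not> X_zero \<psi> v"
  shows "Sw a a2 c c2 b b2 \<omega> F \<le> J \<psi> v"
  unfolding Sw_def
proof (rule cInf_lower)
  show "bdd_below {J \<psi> v | \<psi> v. H2 \<psi> \<and> H2 v \<and> P \<psi> v = 0 \<and> \<not> X_zero \<psi> v}"
    by (rule bdd_belowI[of _ 0])
      (auto simp: J_eq_energy P_eq_constraint intro!: energy_nonneg finite_energy_jet)
qed (use assms in auto)

lemma ground_state_energy_deriv_eq_0:
  assumes H2: "H2 \<psi>0" "H2 v0" and ground: "P \<psi>0 v0 = 0" "J \<psi>0 v0 = Sw a a2 c c2 b b2 \<omega> F"
    and hk: "H2 h" "H2 k"
  shows "energy_deriv (jet \<psi>0 v0) (jet h k) = 0"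
proof (rule energy_deriv_eq_0_if_minimal)
  show "constraint (jet \<psi>0 v0) = 0"
    using ground(1) P_eq_constraint[OF H2] by simp
  fix \<alpha> \<beta>
  let ?\<psi> = "\<lambda>x. \<alpha> * \<psi>0 x + \<beta> * h x" and ?v = "\<lambda>x. \<alpha> * v0 x + \<beta> * k x"
  let ?U = "\<lambda>x. \<alpha> *\<^sub>R jet \<psi>0 v0 x + \<beta> *\<^sub>R jet h k x"
  assume constraint: "constraint ?U = 0" and nonzero: "\<not> (AE x in lborel. ?U x = 0)"
  note H2' = H2_lincomb(1)[OF H2(1) hk(1), of \<alpha> \<beta>] H2_lincomb(1)[OF H2(2) hk(2), of \<alpha> \<beta>]
  have "\<not> X_zero ?\<psi> ?v"
  proof
    assume "X_zero ?\<psi> ?v"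
    from jet_AE_eq_0[OF H2' this] jet_lincomb[OF H2 hk, of \<alpha> \<beta>] have "AE x in lborel. ?U x = 0"
      by eventually_elim simp
    with nonzero show False
      by blast
  qed
  with constraint have "Sw a a2 c c2 b b2 \<omega> F \<le> J ?\<psi> ?v"
    by (intro Sw_le H2') (simp_all add: P_lincomb[OF H2 hk])
  then show "energy (jet \<psi>0 v0) \<le> energy ?U"
    using ground(2) by (simp add: J_lincomb[OF H2 hk] J_eq_energy[OF H2])
qed (use H2 hk in \<open>auto intro: finite_energy_jet\<close>)

lemma Jw_critical_if_energy_deriv_eq_0:
  assumes H2: "H2 \<psi>0" "H2 v0"
    and deriv: "\<And>h k. H2 h \<Longrightarrow> H2 k \<Longrightarrow> energy_deriv (jet \<psi>0 v0) (jet h k) = 0"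
  shows "Jw_critical a a2 c c2 b b2 \<omega> F \<psi>0 v0"
  unfolding Jw_critical_def
proof (intro allI impI)
  fix \<epsilon> :: real assume "\<epsilon> > 0"
  obtain C where C: "C \<ge> 0" "\<And>Y. finite_energy Y \<Longrightarrow> AE x in lborel. norm (fst (Y x)) \<le> 10 \<Longrightarrow>
      \<bar>energy (\<lambda>x. jet \<psi>0 v0 x + Y x) - energy (jet \<psi>0 v0) - energy_deriv (jet \<psi>0 v0) Y\<bar>
        \<le> C * (LINT x|lborel. (norm (Y x))\<^sup>2)"
    using energy_remainder[OF finite_energy_jet[OF H2], of 10] by blast
  let ?\<Delta> = "\<lambda>h k. \<bar>J (\<lambda>x. \<psi>0 x + h x) (\<lambda>x. v0 x + k x) - J \<psi>0 v0\<bar>"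
  have "?\<Delta> h k \<le> \<epsilon> * X_norm h k"
    if hk: "H2 h" "H2 k" and small: "X_norm h k < min 1 (\<epsilon> / (C + 1))" for h k
  proof -
    have "AE x in lborel. norm (fst (jet h k x)) \<le> 10"
      using jet_ess_bound[OF hk] by eventually_elim (use small in linarith)
    then have "?\<Delta> h k \<le> C * (X_norm h k)\<^sup>2"
      using C(2)[OF finite_energy_jet[OF hk]] J_lincomb[OF H2 hk, of 1 1]
      by (simp add: deriv[OF hk] integral_norm_jet_sq[OF hk] J_eq_energy[OF H2])
    also have "\<dots> = (C * X_norm h k) * X_norm h k"
      by (simp add: power2_eq_square)
    also have "\<dots> \<le> \<epsilon> * X_norm h k"
    proof (rule mult_right_mono[OF _ X_norm_nonneg])
      have "X_norm h k * (C + 1) \<le> \<epsilon>"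
        using small C(1) by (simp add: pos_less_divide_eq)
      with X_norm_nonneg[of h k] show "C * X_norm h k \<le> \<epsilon>"
        by (simp add: algebra_simps)
    qed
    finally show ?thesis .
  qed
  then show "\<exists>\<delta>>0. \<forall>h k. H2 h \<and> H2 k \<and> X_norm h k < \<delta> \<longrightarrow> ?\<Delta> h k \<le> \<epsilon> * X_norm h k"
    using \<open>\<epsilon> > 0\<close> C(1) by (intro exI[of _ "min 1 (\<epsilon> / (C + 1))"]) auto
qed

end

theorem theorem2p5:
  fixes a c a2 c2 b b2 \<omega> :: real
    and F :: "real^4 \<Rightarrow> real"
    and \<psi>0 v0 :: "real \<Rightarrow> real"
  assumes "a < 0" "c < 0" "a2 > 0" "c2 > 0" "b > 0" "b2 > 0"
    and "0 < \<bar>\<omega>\<bar>"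
    and "\<bar>\<omega>\<bar> < Min {1, -a / b, -c / b, a2 / b2, c2 / b2}"
    and "C2_R4 F" and "F 0 = 0"
    and cond_a: "\<exists>p>0. \<forall>w. w \<bullet> grad (Gfun F) w \<ge> (p + 2) * Gfun F w"
    and cond_b: "\<exists>q1 q2 C. 0 < q1 \<and> q1 \<le> q2 \<and> C > 0 \<and>
                   (\<forall>w. norm (hess F w) \<le> C * (norm w powr q1 + norm w powr q2))"
    and cond_c: "\<exists>u v. H2 u \<and> H2 v \<and>
                   (LINT x|lborel. F (vec4 (u x) (wd u x) (v x) (wd v x))) > 0"
    and "H2 \<psi>0" "H2 v0"
    and "Pw a a2 c c2 b b2 \<omega> F \<psi>0 v0 = 0"
    and "Jw a a2 c c2 b b2 \<omega> F \<psi>0 v0 = Sw a a2 c c2 b b2 \<omega> F"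
  shows "Jw_critical a a2 c c2 b b2 \<omega> F \<psi>0 v0"
proof -
  obtain p where "p > 0" "\<And>w. (p + 2) * Gfun F w \<le> w \<bullet> grad (Gfun F) w"
    using cond_a by blast
  then interpret boussinesq a a2 c c2 b b2 \<omega> F p
    using assms by unfold_locales
  show ?thesis
  proof (rule Jw_critical_if_energy_deriv_eq_0)
    show "energy_deriv (jet \<psi>0 v0) (jet h k) = 0" if "H2 h" "H2 k" for h k
      using assms that by (intro ground_state_energy_deriv_eq_0)
  qed fact+
qed

end
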